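(* Let $T$ be a complete simple theory, let $(p_w(x_w))_{w\in W}$ be an amalgamation system over a set of parameters $A$, and let $B\supseteq A$ be such that every $p_w(x_w)$ has a unique nonforking extension $q_w(x_w)$ to $B$. Then $(q_w(x_w))_{w\in W}$ is an amalgamation system over $B$.
   Context: Independence is nonforking independence. For finite $W\subseteq\mathfrak{P}(\mathbb{N})$ closed under subsets, a $W$-amalgamation system over $C$ is a family $(p_w(x_w))_{w\in W}$ of complete types over $C$ such that: (1) for distinct variables $y,z$ in $x_w$, $p_w\vdash y\ne z$; (2) $x_v\cap x_w=x_{v\cap w}$ for all $v,w\in W$ and $p_w\upharpoonright x_v=p_v$ whenever $v\subseteq w$; (3) for any realization $b_w$ of $p_w$, with $b_i=b_w\upharpoonright x_{\{i\}}$ for $i\in w$, the family $(b_i)_{i\in w}$ is independent over $C$ and $b_w$ is algebraic over $C\cup\{b_i:i\in w\}$. *)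

theory Defs
  imports Main
begin

unbundle cardinal_syntax

section \<open>First-order logic\<close>

text \<open>
  Free variables and parameters are ``atoms'', taken from an arbitrary type; bound variables are
  de Bruijn indices. An \<open>L(C)\<close>-formula in the variables \<open>x\<close> is a formula over the atom type
  \<open>'v + 'm\<close> whose atoms are \<open>Inl v\<close> with \<open>v \<in> x\<close> (variables) or \<open>Inr c\<close> with \<open>c \<in> C\<close>
  (names of parameters). An \<open>L\<close>-formula \<open>\<phi>(x, y)\<close> with \<open>y = (y\<^sub>0, \<dots>, y\<^sub>n\<^sub>-\<^sub>1)\<close> is represented over
  \<open>'v + nat\<close> in the same way.
\<close>

datatype (dead 'f, atms_tm: 'a) tm =
    Bd nat
  | At 'a
  | Fn 'f "('f, 'a) tm list"
  for map: map_tm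

datatype (dead 'f, dead 'r, atms_fm: 'a) fm =
    Eq "('f, 'a) tm" "('f, 'a) tm"
  | Rl 'r "('f, 'a) tm list"
  | Neg "('f, 'r, 'a) fm"
  | Conj "('f, 'r, 'a) fm" "('f, 'r, 'a) fm"
  | Ex "('f, 'r, 'a) fm"
  for map: map_fm

record ('f, 'r) lang =
  funs :: "'f set"
  rels :: "'r set"
  far :: "'f \<Rightarrow> nat"
  rar :: "'r \<Rightarrow> nat"

record ('f, 'r, 'm) struct =
  fint :: "'f \<Rightarrow> 'm list \<Rightarrow> 'm"
  rint :: "'r \<Rightarrow> 'm list \<Rightarrow> bool"

text \<open>The number \<open>k\<close> bounds the de Bruijn indices that may occur unbound.\<close>

primrec wft :: "('f, 'r) lang \<Rightarrow> nat \<Rightarrow> ('f, 'a) tm \<Rightarrow> bool" where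
  "wft L k (Bd i) \<longleftrightarrow> i < k"
| "wft L k (At a) \<longleftrightarrow> True"
| "wft L k (Fn f ts) \<longleftrightarrow> f \<in> funs L \<and> length ts = far L f \<and> list_all (wft L k) ts"

primrec wff :: "('f, 'r) lang \<Rightarrow> nat \<Rightarrow> ('f, 'r, 'a) fm \<Rightarrow> bool" where
  "wff L k (Eq s t) \<longleftrightarrow> wft L k s \<and> wft L k t"
| "wff L k (Rl r ts) \<longleftrightarrow> r \<in> rels L \<and> length ts = rar L r \<and> list_all (wft L k) ts"
| "wff L k (Neg \<phi>) \<longleftrightarrow> wff L k \<phi>"
| "wff L k (Conj \<phi> \<psi>) \<longleftrightarrow> wff L k \<phi> \<and> wff L k \<psi>"
| "wff L k (Ex \<phi>) \<longleftrightarrow> wff L (Suc k) \<phi>"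

primrec val :: "('f, 'r, 'm) struct \<Rightarrow> ('a \<Rightarrow> 'm) \<Rightarrow> 'm list \<Rightarrow> ('f, 'a) tm \<Rightarrow> 'm" where
  "val M e vs (Bd i) = vs ! i"
| "val M e vs (At a) = e a"
| "val M e vs (Fn f ts) = fint M f (map (val M e vs) ts)"

primrec sat :: "('f, 'r, 'm) struct \<Rightarrow> ('a \<Rightarrow> 'm) \<Rightarrow> 'm list \<Rightarrow> ('f, 'r, 'a) fm \<Rightarrow> bool" where
  "sat M e vs (Eq s t) \<longleftrightarrow> val M e vs s = val M e vs t"
| "sat M e vs (Rl r ts) \<longleftrightarrow> rint M r (map (val M e vs) ts)"
| "sat M e vs (Neg \<phi>) \<longleftrightarrow> \<not> sat M e vs \<phi>"
| "sat M e vs (Conj \<phi> \<psi>) \<longleftrightarrow> sat M e vs \<phi> \<and> sat M e vs \<psi>"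
| "sat M e vs (Ex \<phi>) \<longleftrightarrow> (\<exists>a. sat M e (a # vs) \<phi>)"

definition fmls :: "('f, 'r) lang \<Rightarrow> 'v set \<Rightarrow> 'c set \<Rightarrow> ('f, 'r, 'v + 'c) fm set" where
  "fmls L x C = {\<phi>. wff L 0 \<phi> \<and> atms_fm \<phi> \<subseteq> x <+> C}"

definition inst :: "(nat \<Rightarrow> 'm) \<Rightarrow> ('f, 'r, 'v + nat) fm \<Rightarrow> ('f, 'r, 'v + 'm) fm" where
  "inst b \<phi> = map_fm (map_sum id b) \<phi>"

definition holds :: "('f, 'r, 'm) struct \<Rightarrow> ('v \<Rightarrow> 'm) \<Rightarrow> ('f, 'r, 'v + 'm) fm \<Rightarrow> bool" where
  "holds M e \<phi> \<longleftrightarrow> sat M (case_sum e id) [] \<phi>"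

definition sentences :: "('f, 'r) lang \<Rightarrow> ('f, 'r, nat) fm set" where
  "sentences L = {\<phi>. wff L 0 \<phi> \<and> atms_fm \<phi> = {}}"

definition models :: "('f, 'r, 'm) struct \<Rightarrow> ('f, 'r, nat) fm set \<Rightarrow> bool" where
  "models M T \<longleftrightarrow> (\<forall>\<phi>\<in>T. \<forall>e. sat M e [] \<phi>)"

text \<open>Theories are deductively closed. Consistency is not part of this definition: it is only used
  for theories which are given together with a model.\<close>

definition complete_theory :: "('f, 'r) lang \<Rightarrow> ('f, 'r, nat) fm set \<Rightarrow> bool" where
  "complete_theory L T \<longleftrightarrow> T \<subseteq> sentences L \<and> (\<forall>\<phi>\<in>sentences L. \<phi> \<in> T \<or> Neg \<phi> \<in> T)"

section \<open>Types\<close>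

definition consistent :: "('f, 'r, 'm) struct \<Rightarrow> ('f, 'r, 'v + 'm) fm set \<Rightarrow> bool" where
  "consistent M \<Gamma> \<longleftrightarrow> (\<forall>\<Gamma>\<^sub>0\<subseteq>\<Gamma>. finite \<Gamma>\<^sub>0 \<longrightarrow> (\<exists>e. \<forall>\<phi>\<in>\<Gamma>\<^sub>0. holds M e \<phi>))"

definition realizes :: "('f, 'r, 'm) struct \<Rightarrow> ('v \<Rightarrow> 'm) \<Rightarrow> ('f, 'r, 'v + 'm) fm set \<Rightarrow> bool" where
  "realizes M b \<Gamma> \<longleftrightarrow> (\<forall>\<phi>\<in>\<Gamma>. holds M b \<phi>)"

text \<open>\<open>\<Gamma> \<turnstile> \<Or>\<Psi>\<close>, modulo the elementary diagram of \<open>M\<close>; the disjunction is over a finite set \<open>\<Psi>\<close>.\<close>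

definition proves_disj ::
  "('f, 'r, 'm) struct \<Rightarrow> ('f, 'r, 'v + 'm) fm set \<Rightarrow> ('f, 'r, 'v + 'm) fm set \<Rightarrow> bool" where
  "proves_disj M \<Gamma> \<Psi> \<longleftrightarrow>
     (\<exists>\<Gamma>\<^sub>0\<subseteq>\<Gamma>. finite \<Gamma>\<^sub>0 \<and> (\<forall>e. (\<forall>\<phi>\<in>\<Gamma>\<^sub>0. holds M e \<phi>) \<longrightarrow> (\<exists>\<psi>\<in>\<Psi>. holds M e \<psi>)))"

definition complete_type ::
  "('f, 'r) lang \<Rightarrow> ('f, 'r, 'm) struct \<Rightarrow> 'm set \<Rightarrow> 'v set \<Rightarrow> ('f, 'r, 'v + 'm) fm set \<Rightarrow> bool" where
  "complete_type L M C x p \<longleftrightarrow>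
     p \<subseteq> fmls L x C \<and> consistent M p \<and> (\<forall>\<phi>\<in>fmls L x C. \<phi> \<in> p \<or> Neg \<phi> \<in> p)"

text \<open>\<open>tp L M C x b\<close> is the type over \<open>C\<close> of the tuple \<open>b\<restriction>x\<close>.\<close>

definition tp ::
  "('f, 'r) lang \<Rightarrow> ('f, 'r, 'm) struct \<Rightarrow> 'm set \<Rightarrow> 'v set \<Rightarrow> ('v \<Rightarrow> 'm) \<Rightarrow> ('f, 'r, 'v + 'm) fm set"
  where "tp L M C x b = {\<phi> \<in> fmls L x C. holds M b \<phi>}"

definition acl :: "('f, 'r) lang \<Rightarrow> ('f, 'r, 'm) struct \<Rightarrow> 'm set \<Rightarrow> 'm set" where
  "acl L M C = {a. \<exists>\<phi>\<in>fmls L (UNIV :: unit set) C.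
     holds M (\<lambda>_. a) \<phi> \<and> finite {a'. holds M (\<lambda>_. a') \<phi>}}"

section \<open>Monster models\<close>

definition small :: "'k rel \<Rightarrow> 'a set \<Rightarrow> bool" where
  "small \<kappa> X \<longleftrightarrow> |X| <o \<kappa>"

definition saturated :: "('f, 'r) lang \<Rightarrow> 'k rel \<Rightarrow> ('f, 'r, 'm) struct \<Rightarrow> bool" where
  "saturated L \<kappa> M \<longleftrightarrow>
     (\<forall>C p. small \<kappa> C \<longrightarrow> complete_type L M C (UNIV :: unit set) p \<longrightarrow> (\<exists>b. realizes M b p))"

definition automorphism :: "('f, 'r) lang \<Rightarrow> ('f, 'r, 'm) struct \<Rightarrow> ('m \<Rightarrow> 'm) \<Rightarrow> bool" where
  "automorphism L M g \<longleftrightarrow> bij g \<and>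
     (\<forall>f\<in>funs L. \<forall>as. length as = far L f \<longrightarrow> g (fint M f as) = fint M f (map g as)) \<and>
     (\<forall>r\<in>rels L. \<forall>as. length as = rar L r \<longrightarrow> (rint M r (map g as) \<longleftrightarrow> rint M r as))"

text \<open>A map \<open>g\<close> is elementary on \<open>D\<close> iff the families \<open>(d)\<^sub>d\<^sub>\<in>\<^sub>D\<close> and \<open>(g d)\<^sub>d\<^sub>\<in>\<^sub>D\<close>, with the elements
  of \<open>D\<close> serving as variables, have the same type over the empty set.\<close>

definition strongly_homogeneous :: "('f, 'r) lang \<Rightarrow> 'k rel \<Rightarrow> ('f, 'r, 'm) struct \<Rightarrow> bool" where
  "strongly_homogeneous L \<kappa> M \<longleftrightarrow>
     (\<forall>D g. small \<kappa> D \<longrightarrow> tp L M {} D id = tp L M {} D g \<longrightarrow>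
        (\<exists>h. automorphism L M h \<and> (\<forall>d\<in>D. h d = g d)))"

definition monster_model ::
  "('f, 'r) lang \<Rightarrow> ('f, 'r, nat) fm set \<Rightarrow> 'k rel \<Rightarrow> ('f, 'r, 'm) struct \<Rightarrow> bool" where
  "monster_model L T \<kappa> M \<longleftrightarrow>
     Card_order \<kappa> \<and> small \<kappa> (funs L <+> rels L <+> (UNIV :: nat set)) \<and>
     models M T \<and> saturated L \<kappa> M \<and> strongly_homogeneous L \<kappa> M"

section \<open>Forking and simplicity\<close>

definition k_inconsistent ::
  "('f, 'r, 'm) struct \<Rightarrow> nat \<Rightarrow> (nat \<Rightarrow> ('f, 'r, 'v + 'm) fm) \<Rightarrow> bool" where
  "k_inconsistent M k \<Phi> \<longleftrightarrow> (\<forall>I. finite I \<and> card I = k \<longrightarrow> \<not> consistent M (\<Phi> ` I))"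

definition divides ::
  "('f, 'r) lang \<Rightarrow> ('f, 'r, 'm) struct \<Rightarrow> 'm set \<Rightarrow> 'v set \<Rightarrow> ('f, 'r, 'v + 'm) fm \<Rightarrow> bool" where
  "divides L M A x \<psi> \<longleftrightarrow>
     (\<exists>n. \<exists>\<phi>\<in>fmls L x {..<n}. \<exists>b. \<psi> = inst b \<phi> \<and>
        (\<exists>k c. (\<forall>i::nat. tp L M A {..<n} (c i) = tp L M A {..<n} b) \<and>
               k_inconsistent M k (\<lambda>i. inst (c i) \<phi>)))"

definition forks ::
  "('f, 'r) lang \<Rightarrow> ('f, 'r, 'm) struct \<Rightarrow> 'm set \<Rightarrow> 'v set \<Rightarrow> ('f, 'r, 'v + 'm) fm set \<Rightarrow> bool" where
  "forks L M A x \<pi> \<longleftrightarrow>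
     (\<exists>\<Psi>. finite \<Psi> \<and> (\<forall>\<psi>\<in>\<Psi>. divides L M A x \<psi>) \<and> proves_disj M \<pi> \<Psi>)"

definition nonforking_extension ::
  "('f, 'r) lang \<Rightarrow> ('f, 'r, 'm) struct \<Rightarrow> 'm set \<Rightarrow> 'm set \<Rightarrow> 'v set \<Rightarrow>
   ('f, 'r, 'v + 'm) fm set \<Rightarrow> ('f, 'r, 'v + 'm) fm set \<Rightarrow> bool" where
  "nonforking_extension L M A B x p q \<longleftrightarrow>
     complete_type L M B x q \<and> p \<subseteq> q \<and> \<not> forks L M A x q"

text \<open>Independence over \<open>C\<close> of the family of tuples \<open>(b\<restriction>X i)\<^sub>i\<^sub>\<in>\<^sub>w\<close>.\<close>

definition independent ::
  "('f, 'r) lang \<Rightarrow> ('f, 'r, 'm) struct \<Rightarrow> 'm set \<Rightarrow> nat set \<Rightarrow> (nat \<Rightarrow> 'v set) \<Rightarrow> ('v \<Rightarrow> 'm) \<Rightarrow> bool"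
  where
  "independent L M C w X b \<longleftrightarrow>
     (\<forall>i\<in>w. \<not> forks L M C (X i) (tp L M (C \<union> (\<Union>j\<in>w - {i}. b ` X j)) (X i) b))"

text \<open>The tree of parameters is indexed by finite sequences of natural numbers; the branch
  \<open>\<sigma>\<close> consists of the nonempty initial segments of \<open>\<sigma>\<close>.\<close>

definition tree_property :: "('f, 'r, 'm) struct \<Rightarrow> ('f, 'r, nat + nat) fm \<Rightarrow> bool" where
  "tree_property M \<phi> \<longleftrightarrow>
     (\<exists>k. \<exists>c :: nat list \<Rightarrow> nat \<Rightarrow> 'm.
        (\<forall>s. k_inconsistent M k (\<lambda>i. inst (c (s @ [i])) \<phi>)) \<and>
        (\<forall>\<sigma> :: nat \<Rightarrow> nat. consistent M {inst (c (map \<sigma> [0..<n])) \<phi> | n. 0 < n}))"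

text \<open>Simplicity of the complete theory of \<open>M\<close>, for a monster model \<open>M\<close>.\<close>

definition simple_theory :: "('f, 'r) lang \<Rightarrow> ('f, 'r, 'm) struct \<Rightarrow> bool" where
  "simple_theory L M \<longleftrightarrow> (\<forall>\<phi>\<in>fmls L UNIV UNIV. \<not> tree_property M \<phi>)"

section \<open>Amalgamation systems\<close>

definition amalgamation_system ::
  "('f, 'r) lang \<Rightarrow> ('f, 'r, 'm) struct \<Rightarrow> 'm set \<Rightarrow> nat set set \<Rightarrow>
   (nat set \<Rightarrow> 'v set) \<Rightarrow> (nat set \<Rightarrow> ('f, 'r, 'v + 'm) fm set) \<Rightarrow> bool" where
  "amalgamation_system L M C W x p \<longleftrightarrow>
     finite W \<and> (\<forall>w\<in>W. \<forall>v\<subseteq>w. v \<in> W) \<and>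
     (\<forall>w\<in>W. complete_type L M C (x w) (p w)) \<and>
     (\<forall>w\<in>W. \<forall>y\<in>x w. \<forall>z\<in>x w. y \<noteq> z \<longrightarrow>
        proves_disj M (p w) {Neg (Eq (At (Inl y)) (At (Inl z)))}) \<and>
     (\<forall>v\<in>W. \<forall>w\<in>W. x v \<inter> x w = x (v \<inter> w)) \<and>
     (\<forall>v\<in>W. \<forall>w\<in>W. v \<subseteq> w \<longrightarrow> p w \<inter> fmls L (x v) C = p v) \<and>
     (\<forall>w\<in>W. \<forall>b. realizes M b (p w) \<longrightarrow>
        independent L M C w (\<lambda>i. x {i}) b \<and>
        b ` x w \<subseteq> acl L M (C \<union> (\<Union>i\<in>w. b ` x {i})))"

end

theory Submission
  imports Defs "HOL-Library.Countable_Set"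
begin

text \<open>
  Let \<open>b\<close> realize \<open>q\<^sub>w\<close>, fix \<open>i \<in> w\<close> and let \<open>a\<close> consist of the \<open>b\<^sub>j\<close> with \<open>j \<noteq> i\<close>. Since
  \<open>tp(b\<^sub>i/Aa)\<close> does not fork over \<open>A\<close>, some automorphism over \<open>Aa\<close> takes \<open>b\<close> to a realization \<open>e\<close> of
  \<open>p\<^sub>w\<close> such that \<open>tp(e\<^sub>i/Ba)\<close> does not fork over \<open>A\<close>. As \<open>tp(a/B)\<close> does not fork over \<open>A\<close> and \<open>e\<close> is
  algebraic over \<open>Aae\<^sub>i\<close>, left transitivity of nonforking shows that \<open>tp(e/B)\<close> does not fork over \<open>A\<close>.
  By uniqueness it is \<open>q\<^sub>w = tp(b/B)\<close>, so \<open>tp(b\<^sub>i/Ba)\<close> does not fork over \<open>A\<close>, and a fortiori not over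
  \<open>B\<close>.

  Left transitivity rests on the following: if \<open>\<psi>(x, d)\<close> divides over \<open>A\<close> and \<open>tp(a/Ad)\<close> does not
  fork over \<open>A\<close>, then \<open>\<psi>(x, d)\<close> divides over \<open>Aa\<close>. Moving the base upwards in this way
  eventually makes the realization of \<open>\<psi>(x, d)\<close> algebraic over the base, where it can satisfy no
  dividing formula.
\<close>

section \<open>Formulas\<close>

lemma val_cong: "(\<And>a. a \<in> atms_tm t \<Longrightarrow> e a = e' a) \<Longrightarrow> val M e vs t = val M e' vs t"
proof (induction t)
  case (Fn f ts)
  then have "map (val M e vs) ts = map (val M e' vs) ts" by auto
  then show ?case by (simp del: map_eq_conv)
qed auto

lemma sat_cong: "(\<And>a. a \<in> atms_fm \<phi> \<Longrightarrow> e a = e' a) \<Longrightarrow> sat M e vs \<phi> \<longleftrightarrow> sat M e' vs \<phi>"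
proof (induction \<phi> arbitrary: vs)
  case (Eq s t)
  have "val M e vs s = val M e' vs s" "val M e vs t = val M e' vs t"
    by (rule val_cong; simp add: Eq)+
  then show ?case by simp
next
  case (Rl r ts)
  then have "map (val M e vs) ts = map (val M e' vs) ts" by (auto intro!: val_cong)
  then show ?case by (simp del: map_eq_conv)
qed auto

lemma val_map: "val M e vs (map_tm \<sigma> t) = val M (e \<circ> \<sigma>) vs t"
proof (induction t)
  case (Fn f ts)
  then have "map (val M e vs) (map (map_tm \<sigma>) ts) = map (val M (e \<circ> \<sigma>) vs) ts" by (auto simp: o_def)
  then show ?case by (simp del: map_eq_conv map_map comp_apply)
qed auto

lemma sat_map: "sat M e vs (map_fm \<sigma> \<phi>) \<longleftrightarrow> sat M (e \<circ> \<sigma>) vs \<phi>"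
proof (induction \<phi> arbitrary: vs)
  case (Rl r ts)
  have "map (val M e vs) (map (map_tm \<sigma>) ts) = map (val M (e \<circ> \<sigma>) vs) ts" by (auto simp: val_map)
  then show ?case by (simp del: map_eq_conv map_map comp_apply)
qed (auto simp: val_map simp del: comp_apply)

lemma wft_map [simp]: "wft L k (map_tm \<sigma> t) \<longleftrightarrow> wft L k t"
  by (induction t) (auto simp: list_all_iff)

lemma wff_map [simp]: "wff L k (map_fm \<sigma> \<phi>) \<longleftrightarrow> wff L k \<phi>"
  by (induction \<phi> arbitrary: k) (auto simp: list_all_iff)

lemma finite_atms_tm [simp]: "finite (atms_tm t)"
  by (induction t) auto

lemma finite_atms_fm [simp]: "finite (atms_fm \<phi>)"
  by (induction \<phi>) auto

text \<open>The atom \<open>a\<close> is bound at a depth of \<open>k\<close> binders. No index has to be shifted, because this is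
  only applied to terms and formulas whose own unbound indices are below \<open>k\<close>.\<close>

primrec abst_tm :: "'a \<Rightarrow> nat \<Rightarrow> ('f, 'a) tm \<Rightarrow> ('f, 'a) tm" where
  "abst_tm a k (Bd i) = Bd i"
| "abst_tm a k (At b) = (if b = a then Bd k else At b)"
| "abst_tm a k (Fn f ts) = Fn f (map (abst_tm a k) ts)"

primrec abst_fm :: "'a \<Rightarrow> nat \<Rightarrow> ('f, 'r, 'a) fm \<Rightarrow> ('f, 'r, 'a) fm" where
  "abst_fm a k (Eq s t) = Eq (abst_tm a k s) (abst_tm a k t)"
| "abst_fm a k (Rl r ts) = Rl r (map (abst_tm a k) ts)"
| "abst_fm a k (Neg \<phi>) = Neg (abst_fm a k \<phi>)"
| "abst_fm a k (Conj \<phi> \<psi>) = Conj (abst_fm a k \<phi>) (abst_fm a k \<psi>)"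
| "abst_fm a k (Ex \<phi>) = Ex (abst_fm a (Suc k) \<phi>)"

lemma wft_abst: "wft L k t \<Longrightarrow> wft L (Suc k) (abst_tm a k t)"
  by (induction t) (auto simp: list_all_iff)

lemma wff_abst: "wff L k \<phi> \<Longrightarrow> wff L (Suc k) (abst_fm a k \<phi>)"
  by (induction \<phi> arbitrary: k) (auto simp: list_all_iff wft_abst)

lemma atms_abst_tm: "atms_tm (abst_tm a k t) = atms_tm t - {a}"
  by (induction t) auto

lemma atms_abst_fm: "atms_fm (abst_fm a k \<phi>) = atms_fm \<phi> - {a}"
  by (induction \<phi> arbitrary: k) (auto simp: atms_abst_tm)

lemma val_abst:
  "wft L (length vs) t \<Longrightarrow> val M e (vs @ [m]) (abst_tm a (length vs) t) = val M (e(a := m)) vs t"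
proof (induction t)
  case (Fn f ts)
  then have "map (val M e (vs @ [m])) (map (abst_tm a (length vs)) ts) = map (val M (e(a := m)) vs) ts"
    by (auto simp: list_all_iff simp del: fun_upd_apply)
  then show ?case by (simp del: map_eq_conv map_map fun_upd_apply)
qed (auto simp: nth_append)

lemma sat_abst:
  "wff L (length vs) \<phi> \<Longrightarrow>
   sat M e (vs @ [m]) (abst_fm a (length vs) \<phi>) \<longleftrightarrow> sat M (e(a := m)) vs \<phi>"
proof (induction \<phi> arbitrary: vs)
  case (Rl r ts)
  then have "map (val M e (vs @ [m])) (map (abst_tm a (length vs)) ts) = map (val M (e(a := m)) vs) ts"
    by (auto simp: list_all_iff val_abst)
  then show ?case by (simp del: map_eq_conv map_map fun_upd_apply)
next
  case (Ex \<phi>)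
  then show ?case using Ex.IH[of "_ # vs"] by (auto simp del: fun_upd_apply)
qed (auto simp: val_abst simp del: fun_upd_apply)

lemma sat_Ex_abst:
  "wff L 0 \<phi> \<Longrightarrow> sat M e [] (Ex (abst_fm a 0 \<phi>)) \<longleftrightarrow> (\<exists>m. sat M (e(a := m)) [] \<phi>)"
  using sat_abst[of L "[]" \<phi> M e _ a] by (simp del: fun_upd_apply)

lemma finite_quantification:
  fixes M :: "('f, 'r, 'm) struct"
  assumes "finite S" and "wff L 0 \<phi>"
  shows "\<exists>\<chi>. wff L 0 \<chi> \<and> atms_fm \<chi> = atms_fm \<phi> - S \<and>
    (\<forall>e. sat M e [] \<chi> \<longleftrightarrow> (\<exists>e'. sat M (override_on e e' S) [] \<phi>))"
  using assms
proof (induction S)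
  case empty
  then show ?case by (intro exI[of _ \<phi>]) simp
next
  case (insert s S)
  then obtain \<chi> where \<chi>: "wff L 0 \<chi>" "atms_fm \<chi> = atms_fm \<phi> - S"
    "\<forall>e. sat M e [] \<chi> \<longleftrightarrow> (\<exists>e'. sat M (override_on e e' S) [] \<phi>)" by auto
  have override: "override_on (e(s := m)) e' S = override_on e (e'(s := m)) (insert s S)" for e e' m
    using insert.hyps(2) by (auto simp: override_on_def)
  have "sat M e [] (Ex (abst_fm s 0 \<chi>)) \<longleftrightarrow> (\<exists>e'. sat M (override_on e e' (insert s S)) [] \<phi>)" for e
  proof -
    have "sat M e [] (Ex (abst_fm s 0 \<chi>)) \<longleftrightarrow>
        (\<exists>m e'. sat M (override_on e (e'(s := m)) (insert s S)) [] \<phi>)"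
      by (simp only: sat_Ex_abst[OF \<chi>(1)] \<chi>(3) override)
    also have "\<dots> \<longleftrightarrow> (\<exists>e'. sat M (override_on e e' (insert s S)) [] \<phi>)"
      by (metis fun_upd_triv)
    finally show ?thesis .
  qed
  moreover have "wff L 0 (Ex (abst_fm s 0 \<chi>))"
    and "atms_fm (Ex (abst_fm s 0 \<chi>)) = atms_fm \<phi> - insert s S"
    using \<chi> by (auto simp: atms_abst_fm wff_abst)
  ultimately show ?case by blast
qed

definition fvars :: "('f, 'r, 'v + 'c) fm \<Rightarrow> 'v set" where
  "fvars \<phi> = {v. Inl v \<in> atms_fm \<phi>}"

definition params :: "('f, 'r, 'v + 'c) fm \<Rightarrow> 'c set" where
  "params \<phi> = {c. Inr c \<in> atms_fm \<phi>}"

lemma finite_fvars [simp]: "finite (fvars \<phi>)"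
  using finite_vimageI[OF finite_atms_fm inj_Inl] by (simp add: fvars_def vimage_def)

lemma finite_params [simp]: "finite (params \<phi>)"
  using finite_vimageI[OF finite_atms_fm inj_Inr] by (simp add: params_def vimage_def)

lemma fmls_iff:
  fixes \<phi> :: "('f, 'r, 'v + 'c) fm"
  shows "\<phi> \<in> fmls L x C \<longleftrightarrow> wff L 0 \<phi> \<and> fvars \<phi> \<subseteq> x \<and> params \<phi> \<subseteq> C"
proof -
  have "S \<subseteq> x <+> C \<longleftrightarrow> {v. Inl v \<in> S} \<subseteq> x \<and> {c. Inr c \<in> S} \<subseteq> C"
    for S :: "('v + 'c) set"
  proof (intro iffI conjI subsetI)
    fix s assume "{v. Inl v \<in> S} \<subseteq> x \<and> {c. Inr c \<in> S} \<subseteq> C" "s \<in> S"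
    then show "s \<in> x <+> C" by (cases s) auto
  qed auto
  then show ?thesis by (simp add: fmls_def fvars_def params_def)
qed

lemma fmls_mono: "x \<subseteq> x' \<Longrightarrow> C \<subseteq> C' \<Longrightarrow> fmls L x C \<subseteq> fmls L x' C'"
  by (fastforce simp: fmls_def)

lemma Neg_fmls [simp]: "Neg \<phi> \<in> fmls L x C \<longleftrightarrow> \<phi> \<in> fmls L x C"
  by (simp add: fmls_def)

lemma Eq_At_fmls: "Eq (At a) (At a') \<in> fmls L x C \<longleftrightarrow> a \<in> x <+> C \<and> a' \<in> x <+> C"
  by (auto simp: fmls_def)

lemma map_fmls:
  assumes "\<phi> \<in> fmls L x C" and "\<And>v. v \<in> x \<Longrightarrow> \<sigma> (Inl v) \<in> y <+> D"
    and "\<And>c. c \<in> C \<Longrightarrow> \<sigma> (Inr c) \<in> y <+> D"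
  shows "map_fm \<sigma> \<phi> \<in> fmls L y D"
  using assms by (fastforce simp: fmls_def fm.set_map)

lemma holds_Neg [simp]: "holds M e (Neg \<phi>) \<longleftrightarrow> \<not> holds M e \<phi>"
  by (simp add: holds_def)

lemma holds_cong:
  assumes "\<And>v. v \<in> fvars \<phi> \<Longrightarrow> e v = e' v"
  shows "holds M e \<phi> \<longleftrightarrow> holds M e' \<phi>"
  unfolding holds_def
proof (rule sat_cong)
  fix a assume a: "a \<in> atms_fm \<phi>"
  show "case_sum e id a = case_sum e' id a"
  proof (cases a)
    case (Inl v)
    then show ?thesis using a assms[of v] by (simp add: fvars_def)
  qed simp
qed

lemma holds_map:
  assumes "\<phi> \<in> fmls L x C" and "\<And>v. v \<in> x \<Longrightarrow> case_sum e id (\<sigma> (Inl v)) = e' v"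
    and "\<And>c. c \<in> C \<Longrightarrow> case_sum e id (\<sigma> (Inr c)) = c"
  shows "holds M e (map_fm \<sigma> \<phi>) \<longleftrightarrow> holds M e' \<phi>"
  unfolding holds_def sat_map using assms by (intro sat_cong) (auto simp: fmls_def)

lemma conjunction_formula:
  fixes \<Delta> :: "('f, 'r, 'v + 'm) fm set" and M :: "('f, 'r, 'm) struct"
  assumes "finite \<Delta>" and "\<Delta> \<subseteq> fmls L x C"
  shows "\<exists>\<chi>\<in>fmls L x C. \<forall>e. holds M e \<chi> \<longleftrightarrow> (\<forall>\<phi>\<in>\<Delta>. holds M e \<phi>)"
  using assms
proof (induction \<Delta>)
  case empty
  show ?case by (rule bexI[of _ "Ex (Eq (Bd 0) (Bd 0))"]) (simp_all add: fmls_def holds_def)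
next
  case (insert \<phi> \<Delta>)
  then obtain \<chi> where "\<chi> \<in> fmls L x C" "\<forall>e. holds M e \<chi> \<longleftrightarrow> (\<forall>\<phi>\<in>\<Delta>. holds M e \<phi>)" by auto
  with insert.prems show ?case
    by (intro bexI[of _ "Conj \<phi> \<chi>"]) (simp_all add: fmls_def holds_def)
qed

text \<open>Only the finitely many variables of \<open>\<phi>\<close> outside \<open>S\<close> are quantified.\<close>

lemma exists_formula:
  fixes \<phi> :: "('f, 'r, 'v + 'm) fm" and M :: "('f, 'r, 'm) struct"
  assumes \<phi>: "\<phi> \<in> fmls L x C"
  shows "\<exists>\<chi>\<in>fmls L (x \<inter> S) C. \<forall>e. holds M e \<chi> \<longleftrightarrow> (\<exists>e'. (\<forall>v\<in>S. e' v = e v) \<and> holds M e' \<phi>)"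
proof -
  have "finite (Inl ` (fvars \<phi> - S))" "wff L 0 \<phi>" using \<phi> by (simp_all add: fmls_iff)
  then obtain \<chi> where \<chi>: "wff L 0 \<chi>" "atms_fm \<chi> = atms_fm \<phi> - Inl ` (fvars \<phi> - S)"
    and sat_\<chi>: "\<And>e. sat M e [] \<chi> \<longleftrightarrow> (\<exists>e'. sat M (override_on e e' (Inl ` (fvars \<phi> - S))) [] \<phi>)"
    using finite_quantification by metis
  have override: "override_on (case_sum e id) e' (Inl ` V) = case_sum (override_on e (e' \<circ> Inl) V) id"
    for e e' V by (auto simp: override_on_def fun_eq_iff split: sum.splits)
  have "holds M e \<chi> \<longleftrightarrow> (\<exists>e'. (\<forall>v\<in>S. e' v = e v) \<and> holds M e' \<phi>)" for e
  proof
    assume "holds M e \<chi>"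
    then obtain e' :: "'v + 'm \<Rightarrow> 'm" where "holds M (override_on e (e' \<circ> Inl) (fvars \<phi> - S)) \<phi>"
      unfolding holds_def sat_\<chi> override by blast
    moreover have "\<forall>v\<in>S. override_on e (e' \<circ> Inl) (fvars \<phi> - S) v = e v" by simp
    ultimately show "\<exists>e'. (\<forall>v\<in>S. e' v = e v) \<and> holds M e' \<phi>" by blast
  next
    assume "\<exists>e'. (\<forall>v\<in>S. e' v = e v) \<and> holds M e' \<phi>"
    then obtain e' where e': "\<forall>v\<in>S. e' v = e v" "holds M e' \<phi>" by blast
    have "holds M (override_on e e' (fvars \<phi> - S)) \<phi> \<longleftrightarrow> holds M e' \<phi>"
      using e'(1) by (intro holds_cong) (auto simp: override_on_def)
    with e'(2) show "holds M e \<chi>" unfolding holds_def sat_\<chi> override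
      by (intro exI[of _ "case_sum e' id"]) (simp add: comp_def)
  qed
  moreover have "fvars \<chi> = fvars \<phi> \<inter> S" "params \<chi> = params \<phi>"
    by (auto simp: fvars_def params_def \<chi>(2))
  then have "\<chi> \<in> fmls L (x \<inter> S) C" using \<chi>(1) \<phi> by (auto simp: fmls_iff)
  ultimately show ?thesis by auto
qed

lemma projection_formula:
  assumes "finite \<Delta>" and "\<Delta> \<subseteq> fmls L x C"
  shows "\<exists>\<chi>\<in>fmls L (x \<inter> S) C.
    \<forall>e. holds M e \<chi> \<longleftrightarrow> (\<exists>e'. (\<forall>v\<in>S. e' v = e v) \<and> (\<forall>\<phi>\<in>\<Delta>. holds M e' \<phi>))"
proof -
  obtain \<xi> where "\<xi> \<in> fmls L x C" and \<xi>: "\<forall>e. holds M e \<xi> \<longleftrightarrow> (\<forall>\<phi>\<in>\<Delta>. holds M e \<phi>)"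
    by (rule bexE[OF conjunction_formula[OF assms]])
  from exists_formula[OF this(1), of S M] show ?thesis by (simp only: \<xi>)
qed

section \<open>Types\<close>

lemma tp_cong: "(\<And>v. v \<in> x \<Longrightarrow> b v = b' v) \<Longrightarrow> tp L M C x b = tp L M C x b'"
  unfolding tp_def by (intro Collect_cong conj_cong refl holds_cong) (auto simp: fmls_iff)

lemma tp_eqD:
  "tp L M C x b = tp L M C x b' \<Longrightarrow> \<phi> \<in> fmls L x C \<Longrightarrow> holds M b \<phi> \<longleftrightarrow> holds M b' \<phi>"
  by (auto simp: tp_def)

lemma tp_eqI:
  "(\<And>\<phi>. \<phi> \<in> fmls L x C \<Longrightarrow> holds M b \<phi> \<longleftrightarrow> holds M b' \<phi>) \<Longrightarrow> tp L M C x b = tp L M C x b'"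
  by (auto simp: tp_def)

lemma tp_mono: "C' \<subseteq> C \<Longrightarrow> x' \<subseteq> x \<Longrightarrow> tp L M C' x' b \<subseteq> tp L M C x b"
  using fmls_mono[of x' x C' C] by (auto simp: tp_def)

lemma complete_type_tp: "complete_type L M C x (tp L M C x b)"
  unfolding complete_type_def consistent_def tp_def by auto

lemma complete_type_realized:
  assumes "complete_type L M C x p" and "realizes M b p"
  shows "p = tp L M C x b"
  using assms holds_Neg unfolding complete_type_def realizes_def tp_def by blast

lemma realizes_tp_iff: "realizes M b' (tp L M C x b) \<longleftrightarrow> tp L M C x b' = tp L M C x b"
  using complete_type_realized[OF complete_type_tp] by (fastforce simp: realizes_def tp_def)

lemma consistentD:
  assumes "consistent M \<Gamma>" and "\<Delta> \<subseteq> \<Gamma>" and "finite \<Delta>"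
  obtains e where "\<forall>\<phi>\<in>\<Delta>. holds M e \<phi>"
  using assms unfolding consistent_def by meson

lemma consistent_mono: "consistent M \<Gamma> \<Longrightarrow> \<Delta> \<subseteq> \<Gamma> \<Longrightarrow> consistent M \<Delta>"
  unfolding consistent_def by blast

lemma consistent_finite: "finite \<Gamma> \<Longrightarrow> consistent M \<Gamma> \<longleftrightarrow> (\<exists>e. \<forall>\<phi>\<in>\<Gamma>. holds M e \<phi>)"
  unfolding consistent_def by (meson subsetD subset_refl)

lemma complete_type_restrict:
  assumes "complete_type L M C x p" and "C' \<subseteq> C" and "x' \<subseteq> x"
  shows "complete_type L M C' x' (p \<inter> fmls L x' C')"
  using assms fmls_mono[OF assms(3,2)] consistent_mono[of M p]
  unfolding complete_type_def by fastforce

lemma consistent_directed_Union: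
  assumes "\<C> \<noteq> {}" and "\<And>\<Gamma>. \<Gamma> \<in> \<C> \<Longrightarrow> consistent M \<Gamma>"
    and directed: "\<And>\<Gamma> \<Gamma>'. \<Gamma> \<in> \<C> \<Longrightarrow> \<Gamma>' \<in> \<C> \<Longrightarrow> \<exists>\<Gamma>''\<in>\<C>. \<Gamma> \<union> \<Gamma>' \<subseteq> \<Gamma>''"
  shows "consistent M (\<Union>\<C>)"
  unfolding consistent_def
proof (intro allI impI)
  fix \<Delta> assume "\<Delta> \<subseteq> \<Union>\<C>" "finite \<Delta>"
  from this(2,1) have "\<exists>\<Gamma>\<in>\<C>. \<Delta> \<subseteq> \<Gamma>"
  proof (induction \<Delta>)
    case empty
    then show ?case using \<open>\<C> \<noteq> {}\<close> by blast
  next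
    case (insert \<phi> \<Delta>)
    then obtain \<Gamma> \<Gamma>' where "\<Gamma> \<in> \<C>" "\<Delta> \<subseteq> \<Gamma>" "\<Gamma>' \<in> \<C>" "\<phi> \<in> \<Gamma>'" by auto
    with directed[of \<Gamma> \<Gamma>'] show ?case by blast
  qed
  then show "\<exists>e. \<forall>\<phi>\<in>\<Delta>. holds M e \<phi>"
    using assms(2) \<open>finite \<Delta>\<close> by (meson consistentD)
qed

lemma consistent_finite_stages:
  fixes \<Gamma> :: "nat \<Rightarrow> 'i set \<Rightarrow> ('f, 'r, 'v + 'm) fm set"
  assumes mono: "\<And>N N' \<Delta> \<Delta>'. N \<le> N' \<Longrightarrow> \<Delta> \<subseteq> \<Delta>' \<Longrightarrow> \<Gamma> N \<Delta> \<subseteq> \<Gamma> N' \<Delta>'"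
    and stages: "\<And>N \<Delta>. finite \<Delta> \<Longrightarrow> \<Delta> \<subseteq> R \<Longrightarrow> consistent M (\<Gamma> N \<Delta>)"
  shows "consistent M (\<Union>{\<Gamma> N \<Delta> | N \<Delta>. finite \<Delta> \<and> \<Delta> \<subseteq> R})"
proof (rule consistent_directed_Union)
  fix X Y
  assume "X \<in> {\<Gamma> N \<Delta> | N \<Delta>. finite \<Delta> \<and> \<Delta> \<subseteq> R}" "Y \<in> {\<Gamma> N \<Delta> | N \<Delta>. finite \<Delta> \<and> \<Delta> \<subseteq> R}"
  then obtain N \<Delta> N' \<Delta>' where X: "X = \<Gamma> N \<Delta>" "finite \<Delta>" "\<Delta> \<subseteq> R"
    and Y: "Y = \<Gamma> N' \<Delta>'" "finite \<Delta>'" "\<Delta>' \<subseteq> R" by blast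
  have "X \<union> Y \<subseteq> \<Gamma> (max N N') (\<Delta> \<union> \<Delta>')"
    using mono[of N "max N N'" \<Delta> "\<Delta> \<union> \<Delta>'"] mono[of N' "max N N'" \<Delta>' "\<Delta> \<union> \<Delta>'"] X(1) Y(1) by simp
  moreover have "finite (\<Delta> \<union> \<Delta>')" "\<Delta> \<union> \<Delta>' \<subseteq> R" using X Y by auto
  ultimately show "\<exists>Z\<in>{\<Gamma> N \<Delta> | N \<Delta>. finite \<Delta> \<and> \<Delta> \<subseteq> R}. X \<union> Y \<subseteq> Z" by blast
qed (use stages in blast)+

lemma maximal_consistent:
  assumes "\<Gamma> \<subseteq> \<Phi>" and "consistent M \<Gamma>"
  shows "\<exists>p. \<Gamma> \<subseteq> p \<and> p \<subseteq> \<Phi> \<and> consistent M p \<and> (\<forall>\<phi>\<in>\<Phi>. consistent M (insert \<phi> p) \<longrightarrow> \<phi> \<in> p)"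
proof -
  define \<A> where "\<A> = {p. \<Gamma> \<subseteq> p \<and> p \<subseteq> \<Phi> \<and> consistent M p}"
  have "\<exists>p\<in>\<A>. \<forall>X\<in>\<A>. p \<subseteq> X \<longrightarrow> X = p"
  proof (rule subset_Zorn_nonempty)
    show "\<A> \<noteq> {}" using assms by (auto simp: \<A>_def)
  next
    fix \<C> assume \<C>: "\<C> \<noteq> {}" "subset.chain \<A> \<C>"
    then have sub: "\<C> \<subseteq> \<A>" and chain: "\<And>X Y. X \<in> \<C> \<Longrightarrow> Y \<in> \<C> \<Longrightarrow> X \<union> Y = X \<or> X \<union> Y = Y"
      by (auto simp: subset_chain_def)
    have "consistent M (\<Union>\<C>)"
    proof (rule consistent_directed_Union[OF \<C>(1)])
      show "\<exists>Z\<in>\<C>. X \<union> Y \<subseteq> Z" if "X \<in> \<C>" "Y \<in> \<C>" for X Y using chain[OF that] that by auto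
    qed (use sub in \<open>auto simp: \<A>_def\<close>)
    then show "\<Union>\<C> \<in> \<A>" using \<C> by (auto simp: \<A>_def subset_chain_def)
  qed
  then obtain p where p: "p \<in> \<A>" and max: "\<And>X. X \<in> \<A> \<Longrightarrow> p \<subseteq> X \<Longrightarrow> X = p" by blast
  moreover have "\<phi> \<in> p" if "\<phi> \<in> \<Phi>" "consistent M (insert \<phi> p)" for \<phi>
    using max[of "insert \<phi> p"] p that by (auto simp: \<A>_def)
  ultimately show ?thesis by (intro exI[of _ p]) (auto simp: \<A>_def)
qed

lemma consistent_insert_or_Neg:
  assumes "consistent M p"
  shows "consistent M (insert \<phi> p) \<or> consistent M (insert (Neg \<phi>) p)"
proof (rule ccontr)
  assume "\<not> ?thesis"
  then obtain \<Delta> \<Delta>' where \<Delta>: "\<Delta> \<subseteq> insert \<phi> p" "finite \<Delta>" "\<nexists>e. \<forall>\<chi>\<in>\<Delta>. holds M e \<chi>"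
    and \<Delta>': "\<Delta>' \<subseteq> insert (Neg \<phi>) p" "finite \<Delta>'" "\<nexists>e. \<forall>\<chi>\<in>\<Delta>'. holds M e \<chi>"
    unfolding consistent_def by auto
  have "(\<Delta> - {\<phi>}) \<union> (\<Delta>' - {Neg \<phi>}) \<subseteq> p" using \<Delta>(1) \<Delta>'(1) by blast
  moreover have "finite ((\<Delta> - {\<phi>}) \<union> (\<Delta>' - {Neg \<phi>}))" using \<Delta>(2) \<Delta>'(2) by simp
  ultimately obtain e where "\<forall>\<chi>\<in>(\<Delta> - {\<phi>}) \<union> (\<Delta>' - {Neg \<phi>}). holds M e \<chi>"
    by (rule consistentD[OF assms])
  then show False using \<Delta>(3) \<Delta>'(3) by (metis Diff_iff UnI1 UnI2 holds_Neg singletonD)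
qed

lemma complete_extension:
  assumes "\<Gamma> \<subseteq> fmls L x C" and "consistent M \<Gamma>"
  obtains p where "\<Gamma> \<subseteq> p" and "complete_type L M C x p"
proof -
  obtain p where p: "\<Gamma> \<subseteq> p" "p \<subseteq> fmls L x C" "consistent M p"
    and max: "\<And>\<phi>. \<phi> \<in> fmls L x C \<Longrightarrow> consistent M (insert \<phi> p) \<Longrightarrow> \<phi> \<in> p"
    using maximal_consistent[OF assms] by blast
  have "\<phi> \<in> p \<or> Neg \<phi> \<in> p" if "\<phi> \<in> fmls L x C" for \<phi>
    using consistent_insert_or_Neg[OF p(3)] max that by (metis Neg_fmls)
  with p show thesis using that by (simp add: complete_type_def)
qed

definition value_eq :: "'v \<Rightarrow> 'm \<Rightarrow> ('f, 'r, 'v + 'm) fm" where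
  "value_eq v m = Eq (At (Inl v)) (At (Inr m))"

lemma holds_value_eq [simp]: "holds M e (value_eq v m) \<longleftrightarrow> e v = m"
  by (simp add: value_eq_def holds_def)

lemma value_eq_fmls: "value_eq v m \<in> fmls L x C \<longleftrightarrow> v \<in> x \<and> m \<in> C"
  by (auto simp: value_eq_def Eq_At_fmls)

lemma consistent_value_eq_unique:
  assumes "consistent M p" and "value_eq v m \<in> p" and "value_eq v m' \<in> p"
  shows "m = m'"
  using consistentD[OF assms(1), of "{value_eq v m, value_eq v m'}"] assms(2,3) by auto

lemma consistent_value_eq_holds:
  assumes "consistent M p" and "\<phi> \<in> p" and "\<And>v. v \<in> fvars \<phi> \<Longrightarrow> value_eq v (b v) \<in> p"
  shows "holds M b \<phi>"
proof -
  have "insert \<phi> ((\<lambda>v. value_eq v (b v)) ` fvars \<phi>) \<subseteq> p" using assms(2,3) by blast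
  moreover have "finite (insert \<phi> ((\<lambda>v. value_eq v (b v)) ` fvars \<phi>))" by simp
  ultimately obtain e where "\<forall>\<chi>\<in>insert \<phi> ((\<lambda>v. value_eq v (b v)) ` fvars \<phi>). holds M e \<chi>"
    by (rule consistentD[OF assms(1)])
  then show ?thesis using holds_cong[of \<phi> e b] by simp
qed

lemma proves_disj_mono: "proves_disj M \<Gamma> \<Psi> \<Longrightarrow> \<Gamma> \<subseteq> \<Gamma>' \<Longrightarrow> proves_disj M \<Gamma>' \<Psi>"
  unfolding proves_disj_def by (meson subset_trans)

lemma consistent_consequences:
  assumes "consistent M p"
  shows "consistent M {\<chi>. proves_disj M p {\<chi>}}"
  unfolding consistent_def
proof (intro allI impI)
  fix \<Delta> assume \<Delta>: "\<Delta> \<subseteq> {\<chi>. proves_disj M p {\<chi>}}" "finite \<Delta>"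
  then have "\<forall>\<chi>\<in>\<Delta>. \<exists>\<Gamma>\<subseteq>p. finite \<Gamma> \<and> (\<forall>e. (\<forall>\<phi>\<in>\<Gamma>. holds M e \<phi>) \<longrightarrow> holds M e \<chi>)"
    by (auto simp: proves_disj_def)
  then obtain \<Gamma> where \<Gamma>: "\<forall>\<chi>\<in>\<Delta>. \<Gamma> \<chi> \<subseteq> p \<and> finite (\<Gamma> \<chi>) \<and>
      (\<forall>e. (\<forall>\<phi>\<in>\<Gamma> \<chi>. holds M e \<phi>) \<longrightarrow> holds M e \<chi>)"
    by metis
  have "\<Union> (\<Gamma> ` \<Delta>) \<subseteq> p" "finite (\<Union> (\<Gamma> ` \<Delta>))" using \<Gamma> \<Delta>(2) by auto
  then obtain e where "\<forall>\<phi>\<in>\<Union> (\<Gamma> ` \<Delta>). holds M e \<phi>" by (rule consistentD[OF assms])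
  with \<Gamma> have "\<forall>\<chi>\<in>\<Delta>. holds M e \<chi>" by blast
  then show "\<exists>e. \<forall>\<chi>\<in>\<Delta>. holds M e \<chi>" by blast
qed

section \<open>Saturation and homogeneity\<close>

lemma small_subset: "small \<kappa> X \<Longrightarrow> Y \<subseteq> X \<Longrightarrow> small \<kappa> Y"
  unfolding small_def using card_of_mono1 ordLeq_ordLess_trans by blast

lemma small_image: "small \<kappa> X \<Longrightarrow> small \<kappa> (f ` X)"
  unfolding small_def using card_of_image ordLeq_ordLess_trans by blast

locale monster =
  fixes L :: "('f, 'r) lang" and T :: "('f, 'r, nat) fm set"
    and \<kappa> :: "'k rel" and M :: "('f, 'r, 'm) struct"
  assumes monster_model: "monster_model L T \<kappa> M"
begin

lemma small_nat: "small \<kappa> (UNIV :: nat set)"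
proof -
  have "|UNIV :: nat set| \<le>o |funs L <+> rels L <+> (UNIV :: nat set)|"
    using ordLeq_transitive[OF card_of_Plus2 card_of_Plus2] .
  moreover have "small \<kappa> (funs L <+> rels L <+> (UNIV :: nat set))"
    using monster_model by (simp add: monster_model_def)
  ultimately show ?thesis unfolding small_def by (rule ordLeq_ordLess_trans)
qed

lemma small_countable: "countable X \<Longrightarrow> small \<kappa> X"
  using small_subset[OF small_image[OF small_nat] subset_range_from_nat_into] .

lemma infinite_Field: "infinite (Field \<kappa>)"
proof
  assume "finite (Field \<kappa>)"
  have "|Field \<kappa>| =o \<kappa>" using monster_model by (simp add: monster_model_def card_of_Field_ordIso)
  then have "|UNIV :: nat set| \<le>o |Field \<kappa>|"
    using small_nat ordIso_symmetric ordLess_imp_ordLeq ordLess_ordIso_trans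
    unfolding small_def by blast
  with \<open>finite (Field \<kappa>)\<close> show False using card_of_ordLeq_infinite by blast
qed

lemma small_Un: "small \<kappa> X \<Longrightarrow> small \<kappa> Y \<Longrightarrow> small \<kappa> (X \<union> Y)"
  unfolding small_def using monster_model infinite_Field
  by (simp add: monster_model_def card_of_Un_ordLess_infinite_Field)

lemma small_Plus: "small \<kappa> X \<Longrightarrow> small \<kappa> Y \<Longrightarrow> small \<kappa> (X <+> Y)"
  unfolding small_def using monster_model infinite_Field
  by (simp add: monster_model_def card_of_Plus_ordLess_infinite_Field)

lemma realizable_consequences:
  fixes p :: "('f, 'r, 'v + 'm) fm set"
  assumes C: "small \<kappa> C" and con: "consistent M p"
  obtains m where "\<And>\<chi>. \<chi> \<in> fmls L {v} C \<Longrightarrow> proves_disj M p {\<chi>} \<Longrightarrow> holds M (\<lambda>_. m) \<chi>"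
proof -
  define rename :: "('f, 'r, 'v + 'm) fm \<Rightarrow> ('f, 'r, unit + 'm) fm" where
    "rename = map_fm (map_sum (\<lambda>_. ()) id)"
  have holds_rename: "holds M u (rename \<chi>) \<longleftrightarrow> holds M (\<lambda>_. u ()) \<chi>" if "\<chi> \<in> fmls L {v} C" for u \<chi>
    unfolding rename_def using that by (rule holds_map) auto
  define \<Sigma> where "\<Sigma> = {\<chi> \<in> fmls L {v} C. proves_disj M p {\<chi>}}"
  have "rename ` \<Sigma> \<subseteq> fmls L UNIV C"
    unfolding \<Sigma>_def rename_def by (auto intro!: map_fmls[where x = "{v}"])
  moreover have "consistent M (rename ` \<Sigma>)" unfolding consistent_def
  proof (intro allI impI)
    fix \<Theta> assume "\<Theta> \<subseteq> rename ` \<Sigma>" "finite \<Theta>"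
    then obtain \<Delta> where \<Delta>: "\<Delta> \<subseteq> \<Sigma>" "finite \<Delta>" "\<Theta> = rename ` \<Delta>"
      by (meson finite_subset_image)
    have "\<Delta> \<subseteq> {\<chi>. proves_disj M p {\<chi>}}" using \<Delta>(1) by (auto simp: \<Sigma>_def)
    with consistent_consequences[OF con] obtain e where "\<forall>\<chi>\<in>\<Delta>. holds M e \<chi>"
      using \<Delta>(2) by (rule consistentD)
    moreover have "holds M e \<chi> \<longleftrightarrow> holds M (\<lambda>_. e v) \<chi>" if "\<chi> \<in> \<Delta>" for \<chi>
      using that \<Delta>(1) by (intro holds_cong) (auto simp: \<Sigma>_def fmls_iff)
    ultimately have "\<forall>\<theta>\<in>\<Theta>. holds M (\<lambda>_. e v) \<theta>"
      using \<Delta> holds_rename by (auto simp: \<Sigma>_def)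
    then show "\<exists>u. \<forall>\<theta>\<in>\<Theta>. holds M u \<theta>" by blast
  qed
  ultimately obtain q where q: "rename ` \<Sigma> \<subseteq> q" "complete_type L M C UNIV q"
    by (rule complete_extension)
  from q(2) obtain u where "realizes M u q"
    using C monster_model unfolding monster_model_def saturated_def by blast
  with q(1) have "holds M u (rename \<chi>)" if "\<chi> \<in> \<Sigma>" for \<chi> using that by (auto simp: realizes_def)
  then show thesis using that[of "u ()"] holds_rename by (auto simp: \<Sigma>_def)
qed

lemma consistent_insert_value_eq:
  fixes p :: "('f, 'r, 'v + 'm) fm set"
  assumes C: "small \<kappa> C" and p: "p \<subseteq> fmls L UNIV C" and con: "consistent M p"
  obtains m where "consistent M (insert (value_eq v m) p)"
proof -
  obtain m where m: "\<And>\<chi>. \<chi> \<in> fmls L {v} C \<Longrightarrow> proves_disj M p {\<chi>} \<Longrightarrow> holds M (\<lambda>_. m) \<chi>"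
    using realizable_consequences[OF C con, of v] by blast
  have "consistent M (insert (value_eq v m) p)" unfolding consistent_def
  proof (intro allI impI)
    fix \<Gamma> assume \<Gamma>: "\<Gamma> \<subseteq> insert (value_eq v m) p" "finite \<Gamma>"
    have \<Delta>: "finite (\<Gamma> \<inter> p)" "\<Gamma> \<inter> p \<subseteq> fmls L UNIV C" using \<Gamma>(2) p by auto
    obtain \<chi> where \<chi>: "\<chi> \<in> fmls L (UNIV \<inter> {v}) C"
      and holds_\<chi>: "\<And>e. holds M e \<chi> \<longleftrightarrow>
        (\<exists>e'. (\<forall>u\<in>{v}. e' u = e u) \<and> (\<forall>\<phi>\<in>\<Gamma> \<inter> p. holds M e' \<phi>))"
      using projection_formula[OF \<Delta>, of "{v}" M] by blast
    have "proves_disj M p {\<chi>}"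
      unfolding proves_disj_def using \<Delta>(1) holds_\<chi> by (intro exI[of _ "\<Gamma> \<inter> p"]) auto
    then have "holds M (\<lambda>_. m) \<chi>" using m \<chi> by simp
    then obtain e where "e v = m" "\<forall>\<phi>\<in>\<Gamma> \<inter> p. holds M e \<phi>" unfolding holds_\<chi> by auto
    then have "\<forall>\<phi>\<in>\<Gamma>. holds M e \<phi>" using \<Gamma>(1) by auto
    then show "\<exists>e. \<forall>\<phi>\<in>\<Gamma>. holds M e \<phi>" by blast
  qed
  then show thesis by (rule that)
qed

text \<open>A maximal consistent set of equations \<open>v = m\<close> is the graph of a realization.\<close>

lemma consistent_realizable:
  fixes \<Gamma> :: "('f, 'r, 'v + 'm) fm set"
  assumes x: "small \<kappa> x" and C: "small \<kappa> C" and \<Gamma>: "\<Gamma> \<subseteq> fmls L x C" and con: "consistent M \<Gamma>"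
  obtains b where "realizes M b \<Gamma>"
proof -
  define \<E> where "\<E> = {value_eq v m :: ('f, 'r, 'v + 'm) fm | v m. v \<in> x}"
  obtain p where p: "\<Gamma> \<subseteq> p" "p \<subseteq> \<Gamma> \<union> \<E>" "consistent M p"
    and max: "\<And>\<phi>. \<phi> \<in> \<Gamma> \<union> \<E> \<Longrightarrow> consistent M (insert \<phi> p) \<Longrightarrow> \<phi> \<in> p"
    using maximal_consistent[OF Un_upper1 con, of \<E>] by auto
  define b where "b v = (THE m. value_eq v m \<in> p)" for v
  have b: "b v = m" if "value_eq v m \<in> p" for v m
    unfolding b_def using that consistent_value_eq_unique[OF p(3)] by blast
  have p_fmls: "p \<subseteq> fmls L UNIV (C \<union> b ` x)"
  proof
    fix \<phi> assume \<phi>: "\<phi> \<in> p"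
    then consider (original) "\<phi> \<in> \<Gamma>" | (equation) v m where "\<phi> = value_eq v m" "v \<in> x"
      using p(2) by (auto simp: \<E>_def)
    then show "\<phi> \<in> fmls L UNIV (C \<union> b ` x)"
    proof cases
      case original
      then show ?thesis using subsetD[OF \<Gamma>] by (auto simp: fmls_iff)
    next
      case equation
      then show ?thesis using b \<phi> by (auto simp: value_eq_fmls)
    qed
  qed
  have small: "small \<kappa> (C \<union> b ` x)" by (intro small_Un small_image C x)
  have value_eq_b: "value_eq v (b v) \<in> p" if "v \<in> x" for v
  proof -
    obtain m where "consistent M (insert (value_eq v m) p)"
      by (rule consistent_insert_value_eq[OF small p_fmls p(3)])
    then have "value_eq v m \<in> p" using that by (intro max) (auto simp: \<E>_def)
    then show ?thesis using b by simp
  qed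
  have "holds M b \<phi>" if "\<phi> \<in> \<Gamma>" for \<phi>
    using subsetD[OF \<Gamma> that] subsetD[OF p(1) that] value_eq_b
    by (intro consistent_value_eq_holds[OF p(3)]) (auto simp: fmls_iff)
  then show thesis using that[of b] by (simp add: realizes_def)
qed

end

section \<open>Automorphisms\<close>

definition map_params :: "('c \<Rightarrow> 'd) \<Rightarrow> ('f, 'r, 'v + 'c) fm \<Rightarrow> ('f, 'r, 'v + 'd) fm" where
  "map_params g = map_fm (map_sum id g)"

lemma inst_eq_map_params: "inst = map_params"
  by (simp add: inst_def map_params_def fun_eq_iff)

lemma wff_map_params [simp]: "wff L k (map_params g \<phi>) \<longleftrightarrow> wff L k \<phi>"
  by (simp add: map_params_def)

lemma map_params_fmls: "\<phi> \<in> fmls L x C \<Longrightarrow> map_params g \<phi> \<in> fmls L x (g ` C)"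
  unfolding map_params_def by (rule map_fmls) auto

lemma map_params_map_params: "map_params g (map_params f \<phi>) = map_params (g \<circ> f) \<phi>"
  by (simp add: map_params_def fm.map_comp map_sum.comp)

lemma map_params_cong:
  assumes "\<And>c. c \<in> params \<phi> \<Longrightarrow> f c = g c"
  shows "map_params f \<phi> = map_params g \<phi>"
  unfolding map_params_def
proof (rule fm.map_cong0)
  fix a assume a: "a \<in> atms_fm \<phi>"
  show "map_sum id f a = map_sum id g a"
  proof (cases a)
    case (Inr c)
    then show ?thesis using a assms[of c] by (simp add: params_def)
  qed simp
qed

lemma map_params_ident:
  assumes "\<And>c. c \<in> params \<phi> \<Longrightarrow> g c = c"
  shows "map_params g \<phi> = \<phi>"
proof -
  have "map_params g \<phi> = map_params id \<phi>" using assms by (intro map_params_cong) simp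
  then show ?thesis by (simp add: map_params_def map_sum.id fm.map_id)
qed

lemma holds_map_params: "holds M e (map_params c \<phi>) \<longleftrightarrow> sat M (case_sum e c) [] \<phi>"
proof -
  have "case_sum e id \<circ> map_sum id c = case_sum e c" by (auto split: sum.splits)
  then show ?thesis unfolding holds_def map_params_def sat_map by simp
qed

lemma val_automorphism:
  assumes "automorphism L M g"
  shows "wft L (length vs) t \<Longrightarrow> val M (g \<circ> e) (map g vs) t = g (val M e vs t)"
proof (induction t)
  case (Fn f ts)
  then have "map (val M (g \<circ> e) (map g vs)) ts = map g (map (val M e vs) ts)"
    by (auto simp: list_all_iff o_def)
  then show ?case using Fn.prems assms unfolding automorphism_def
    by (simp del: map_eq_conv map_map comp_apply)
qed auto

lemma sat_automorphism:
  assumes g: "automorphism L M g"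
  shows "wff L (length vs) \<phi> \<Longrightarrow> sat M (g \<circ> e) (map g vs) \<phi> \<longleftrightarrow> sat M e vs \<phi>"
proof (induction \<phi> arbitrary: vs)
  case (Eq s t)
  moreover have "inj g" using g by (simp add: automorphism_def bij_is_inj)
  ultimately show ?case by (simp add: val_automorphism[OF g] inj_eq del: comp_apply)
next
  case (Rl r ts)
  then have "map (val M (g \<circ> e) (map g vs)) ts = map g (map (val M e vs) ts)"
    by (auto simp: list_all_iff val_automorphism[OF g])
  then show ?case using Rl.prems g unfolding automorphism_def
    by (simp del: map_eq_conv map_map comp_apply)
next
  case (Ex \<phi>)
  have "surj g" using g by (simp add: automorphism_def bij_is_surj)
  then have "(\<exists>a. sat M (g \<circ> e) (a # map g vs) \<phi>) \<longleftrightarrow> (\<exists>a. sat M (g \<circ> e) (g a # map g vs) \<phi>)"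
    by (metis surjD)
  then show ?case using Ex.IH[of "_ # vs"] Ex.prems by (simp del: comp_apply)
qed (auto simp del: comp_apply)

lemma automorphism_inv:
  assumes g: "automorphism L M g"
  shows "automorphism L M (inv g)"
proof -
  have bij: "bij g" using g by (simp add: automorphism_def)
  have g_inv: "map g (map (inv g) as) = as" for as
    using bij by (simp add: map_idI bij_is_surj surj_f_inv_f)
  have "inv g (fint M f as) = fint M f (map (inv g) as)"
    if "f \<in> funs L" "length as = far L f" for f as
  proof -
    have "g (fint M f (map (inv g) as)) = fint M f (map g (map (inv g) as))"
      using g that unfolding automorphism_def by (metis length_map)
    then show ?thesis unfolding g_inv using bij by (metis bij_inv_eq_iff)
  qed
  moreover have "rint M r (map (inv g) as) \<longleftrightarrow> rint M r as"
    if "r \<in> rels L" "length as = rar L r" for r as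
  proof -
    have "rint M r (map g (map (inv g) as)) \<longleftrightarrow> rint M r (map (inv g) as)"
      using g that unfolding automorphism_def by (metis length_map)
    then show ?thesis unfolding g_inv by simp
  qed
  ultimately show ?thesis using bij by (simp add: automorphism_def bij_imp_bij_inv)
qed

lemma automorphism_comp:
  assumes "automorphism L M g" and "automorphism L M f"
  shows "automorphism L M (g \<circ> f)"
  using assms unfolding automorphism_def by (simp add: bij_comp flip: map_map)

lemma automorphism_inv_apply:
  assumes "automorphism L M g"
  shows "g (inv g m) = m" and "inv g (g m) = m"
  using assms by (simp_all add: automorphism_def bij_is_inj bij_is_surj surj_f_inv_f)

lemma holds_automorphism:
  assumes g: "automorphism L M g" and "wff L 0 \<phi>"
  shows "holds M e (map_params g \<phi>) \<longleftrightarrow> holds M (inv g \<circ> e) \<phi>"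
proof -
  have "case_sum e g = g \<circ> case_sum (inv g \<circ> e) id"
    by (auto simp: automorphism_inv_apply[OF g] split: sum.splits)
  then show ?thesis
    using sat_automorphism[OF g, of "[]"] assms(2) unfolding holds_map_params by (simp add: holds_def)
qed

lemma k_inconsistent_iff:
  "k_inconsistent M k \<Phi> \<longleftrightarrow>
    (\<forall>I e. finite I \<longrightarrow> card I = k \<longrightarrow> \<not> (\<forall>i\<in>I. holds M e (\<Phi> i)))"
  unfolding k_inconsistent_def by (auto simp: consistent_finite)

lemma k_inconsistent_automorphism:
  assumes g: "automorphism L M g" and "\<And>i. wff L 0 (\<Phi> i)" and "k_inconsistent M k \<Phi>"
  shows "k_inconsistent M k (\<lambda>i. map_params g (\<Phi> i))"
  using assms(3) unfolding k_inconsistent_iff by (simp add: holds_automorphism[OF g assms(2)])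

definition Aut :: "('f, 'r) lang \<Rightarrow> ('f, 'r, 'm) struct \<Rightarrow> 'm set \<Rightarrow> ('m \<Rightarrow> 'm) set" where
  "Aut L M C = {g. automorphism L M g \<and> (\<forall>c\<in>C. g c = c)}"

lemma Aut_automorphism: "g \<in> Aut L M C \<Longrightarrow> automorphism L M g"
  by (simp add: Aut_def)

lemma Aut_fixes: "g \<in> Aut L M C \<Longrightarrow> c \<in> C \<Longrightarrow> g c = c"
  by (simp add: Aut_def)

lemma Aut_antimono: "C \<subseteq> D \<Longrightarrow> Aut L M D \<subseteq> Aut L M C"
  by (auto simp: Aut_def)

lemma Aut_image: "g \<in> Aut L M C \<Longrightarrow> D \<subseteq> C \<Longrightarrow> g ` D = D"
  by (force simp: Aut_def)

lemma Aut_comp: "g \<in> Aut L M C \<Longrightarrow> f \<in> Aut L M C \<Longrightarrow> g \<circ> f \<in> Aut L M C"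
  by (auto simp: Aut_def intro: automorphism_comp)

lemma Aut_inv_comp:
  assumes f: "f \<in> Aut L M A" and g: "g \<in> Aut L M A" and "\<And>c. c \<in> S \<Longrightarrow> g c = f c"
  shows "inv f \<circ> g \<in> Aut L M (A \<union> S)"
proof -
  have "g c = f c" if "c \<in> A \<union> S" for c
    using that assms(3) Aut_fixes[OF f] Aut_fixes[OF g] by auto
  then have "inv f (g c) = c" if "c \<in> A \<union> S" for c
    using that automorphism_inv_apply(2)[OF Aut_automorphism[OF f]] by simp
  moreover have "automorphism L M (inv f \<circ> g)"
    using f g by (intro automorphism_comp automorphism_inv Aut_automorphism)
  ultimately show ?thesis by (simp add: Aut_def)
qed

lemma Aut_conjugate:
  assumes g: "automorphism L M g" and f: "f \<in> Aut L M C"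
  shows "g \<circ> f \<circ> inv g \<in> Aut L M (g ` C)"
  using automorphism_comp[OF automorphism_comp[OF g Aut_automorphism[OF f]] automorphism_inv[OF g]]
    automorphism_inv_apply[OF g] Aut_fixes[OF f] by (auto simp: Aut_def)

lemma tp_Aut:
  assumes g: "g \<in> Aut L M C"
  shows "tp L M C x (g \<circ> b) = tp L M C x b"
proof (rule tp_eqI)
  fix \<phi> assume \<phi>: "\<phi> \<in> fmls L x C"
  then have "map_params g \<phi> = \<phi>"
    using Aut_fixes[OF g] by (intro map_params_ident) (auto simp: fmls_iff)
  moreover have "inv g \<circ> (g \<circ> b) = b" using automorphism_inv_apply[OF Aut_automorphism[OF g]] by auto
  moreover have "wff L 0 \<phi>" using \<phi> by (simp add: fmls_iff)
  ultimately show "holds M (g \<circ> b) \<phi> \<longleftrightarrow> holds M b \<phi>"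
    using holds_automorphism[OF Aut_automorphism[OF g], of \<phi> "g \<circ> b"] by simp
qed

lemma acl_mono: "C \<subseteq> D \<Longrightarrow> acl L M C \<subseteq> acl L M D"
  unfolding acl_def using fmls_mono[of UNIV UNIV C D] by blast

lemma acl_automorphism:
  assumes g: "automorphism L M g" and "a \<in> acl L M C"
  shows "g a \<in> acl L M (g ` C)"
proof -
  obtain \<theta> where \<theta>: "\<theta> \<in> fmls L (UNIV :: unit set) C" "holds M (\<lambda>_. a) \<theta>"
    "finite {a'. holds M (\<lambda>_. a') \<theta>}"
    using assms(2) unfolding acl_def by blast
  have holds_g: "holds M (\<lambda>_. m) (map_params g \<theta>) \<longleftrightarrow> holds M (\<lambda>_. inv g m) \<theta>" for m
    using holds_automorphism[OF g, of \<theta> "\<lambda>_. m"] \<theta>(1) by (simp add: fmls_iff comp_def)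
  have "{m. holds M (\<lambda>_. m) (map_params g \<theta>)} \<subseteq> g ` {a'. holds M (\<lambda>_. a') \<theta>}"
  proof
    fix m assume "m \<in> {m. holds M (\<lambda>_. m) (map_params g \<theta>)}"
    then have "inv g m \<in> {a'. holds M (\<lambda>_. a') \<theta>}" by (simp add: holds_g)
    then show "m \<in> g ` {a'. holds M (\<lambda>_. a') \<theta>}"
      by (rule rev_image_eqI) (simp add: automorphism_inv_apply[OF g])
  qed
  then have "finite {m. holds M (\<lambda>_. m) (map_params g \<theta>)}" using \<theta>(3) finite_subset by blast
  moreover have "holds M (\<lambda>_. g a) (map_params g \<theta>)"
    using \<theta>(2) by (simp add: holds_g automorphism_inv_apply[OF g])
  ultimately show ?thesis using map_params_fmls[OF \<theta>(1)] unfolding acl_def by blast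
qed

lemma acl_finite_orbit:
  assumes "a \<in> acl L M C"
  shows "finite ((\<lambda>g. g a) ` Aut L M C)"
proof -
  obtain \<theta> where \<theta>: "\<theta> \<in> fmls L (UNIV :: unit set) C" "holds M (\<lambda>_. a) \<theta>"
    "finite {a'. holds M (\<lambda>_. a') \<theta>}"
    using assms unfolding acl_def by blast
  have "holds M (\<lambda>_. g a) \<theta>" if "g \<in> Aut L M C" for g
    using tp_eqD[OF tp_Aut[OF that, of UNIV "\<lambda>_. a"] \<theta>(1)] \<theta>(2) by (simp add: comp_def)
  then show ?thesis by (intro finite_subset[OF _ \<theta>(3)]) auto
qed

lemma (in monster) same_type_Aut:
  assumes C: "small \<kappa> C" and x: "small \<kappa> x" and eq: "tp L M C x b' = tp L M C x b"
  obtains h where "h \<in> Aut L M C" and "\<And>v. v \<in> x \<Longrightarrow> h (b v) = b' v"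
proof -
  define \<tau> where "\<tau> = inv_into (x <+> C) (case_sum b id)"
  define g where "g = case_sum b' id \<circ> \<tau>"
  have \<tau>: "\<tau> m \<in> x <+> C" "case_sum b id (\<tau> m) = m" if "m \<in> case_sum b id ` (x <+> C)" for m
    using that by (auto simp: \<tau>_def inv_into_into f_inv_into_f)
  have g: "g (case_sum b id a) = case_sum b' id a" if "a \<in> x <+> C" for a
  proof -
    have "\<tau> (case_sum b id a) \<in> x <+> C" "case_sum b id (\<tau> (case_sum b id a)) = case_sum b id a"
      using \<tau> that by blast+
    then show ?thesis
      using tp_eqD[OF eq, of "Eq (At (\<tau> (case_sum b id a))) (At a)"] that
      by (simp add: Eq_At_fmls g_def holds_def)
  qed
  let ?D = "case_sum b id ` (x <+> C)"
  have "tp L M {} ?D id = tp L M {} ?D g"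
  proof (rule tp_eqI)
    fix \<phi> :: "('f, 'r, 'm + 'm) fm" assume \<phi>: "\<phi> \<in> fmls L ?D {}"
    have "map_fm (case_sum \<tau> Inr) \<phi> \<in> fmls L x C"
      using \<phi> \<tau>(1) by (intro map_fmls[OF \<phi>]) auto
    then have "holds M b' (map_fm (case_sum \<tau> Inr) \<phi>) \<longleftrightarrow> holds M b (map_fm (case_sum \<tau> Inr) \<phi>)"
      by (rule tp_eqD[OF eq])
    moreover have "holds M b (map_fm (case_sum \<tau> Inr) \<phi>) \<longleftrightarrow> holds M id \<phi>"
      using \<tau>(2) by (intro holds_map[OF \<phi>]) simp_all
    moreover have "holds M b' (map_fm (case_sum \<tau> Inr) \<phi>) \<longleftrightarrow> holds M g \<phi>"
      by (intro holds_map[OF \<phi>]) (simp_all add: g_def)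
    ultimately show "holds M id \<phi> \<longleftrightarrow> holds M g \<phi>" by simp
  qed
  moreover have "small \<kappa> ?D" by (intro small_image small_Plus C x)
  ultimately obtain h where h: "automorphism L M h" "\<forall>d\<in>?D. h d = g d"
    using monster_model unfolding monster_model_def strongly_homogeneous_def by blast
  then have "h (case_sum b id a) = case_sum b' id a" if "a \<in> x <+> C" for a using that g by simp
  from this[OF InlI] this[OF InrI] h(1) show thesis by (intro that[of h]) (simp_all add: Aut_def)
qed

section \<open>Dividing and forking\<close>

lemma divides_mono:
  fixes M :: "('f, 'r, 'm) struct"
  assumes "divides L M B x \<psi>" and "A \<subseteq> B" and "x \<subseteq> x'"
  shows "divides L M A x' \<psi>"
proof -
  obtain n \<phi> b k and c :: "nat \<Rightarrow> nat \<Rightarrow> 'm" where \<phi>: "\<phi> \<in> fmls L x {..<n}" "\<psi> = inst b \<phi>"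
    and c: "\<forall>i. tp L M B {..<n} (c i) = tp L M B {..<n} b"
    and inc: "k_inconsistent M k (\<lambda>i. inst (c i) \<phi>)"
    using assms(1) unfolding divides_def by auto
  have "\<phi> \<in> fmls L x' {..<n}" using \<phi>(1) fmls_mono[OF assms(3) subset_refl] by auto
  moreover have "\<forall>i. tp L M A {..<n} (c i) = tp L M A {..<n} b"
    using tp_eqD[OF spec[OF c]] fmls_mono[OF subset_refl assms(2)] by (intro allI tp_eqI) blast
  ultimately show ?thesis unfolding divides_def using \<phi>(2) inc by blast
qed

lemma forks_mono:
  assumes "forks L M B x \<pi>" and "A \<subseteq> B" and "x \<subseteq> x'" and "\<pi> \<subseteq> \<pi>'"
  shows "forks L M A x' \<pi>'"
  using assms(1) divides_mono[OF _ assms(2,3)] proves_disj_mono[OF _ assms(4)]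
  unfolding forks_def by meson

lemma nonforking_extension_restrict:
  assumes ext: "nonforking_extension L M A B x p q" and "p' \<subseteq> p" and "p' \<subseteq> fmls L x' B'"
    and "B' \<subseteq> B" and "x' \<subseteq> x"
  shows "nonforking_extension L M A B' x' p' (q \<inter> fmls L x' B')"
  unfolding nonforking_extension_def
proof (intro conjI)
  show "complete_type L M B' x' (q \<inter> fmls L x' B')"
    using ext assms(4,5) complete_type_restrict unfolding nonforking_extension_def by blast
  show "p' \<subseteq> q \<inter> fmls L x' B'"
    using ext assms(2,3) unfolding nonforking_extension_def by blast
  show "\<not> forks L M A x' (q \<inter> fmls L x' B')"
    using ext assms(5) forks_mono[OF _ subset_refl _ Int_lower1]
    unfolding nonforking_extension_def by blast
qed

lemma divides_fmls: "divides L M A x \<psi> \<Longrightarrow> \<psi> \<in> fmls L x UNIV"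
  using map_params_fmls fmls_mono[OF subset_refl subset_UNIV]
  unfolding divides_def inst_eq_map_params by blast

lemma consistent_negations_of_dividing:
  assumes nf: "\<not> forks L M A x p"
  shows "consistent M (p \<union> Neg ` {\<psi>. divides L M A x \<psi>})"
  unfolding consistent_def
proof (intro allI impI)
  fix \<Delta> assume \<Delta>: "\<Delta> \<subseteq> p \<union> Neg ` {\<psi>. divides L M A x \<psi>}" "finite \<Delta>"
  define \<Psi> where "\<Psi> = {\<psi>. divides L M A x \<psi>} \<inter> Neg -` \<Delta>"
  have "finite \<Psi>"
    unfolding \<Psi>_def using \<Delta>(2) by (intro finite_Int disjI2 finite_vimageI) (auto simp: inj_def)
  then have "\<not> proves_disj M p \<Psi>" using nf by (auto simp: forks_def \<Psi>_def)
  then obtain e where "\<forall>\<phi>\<in>\<Delta> \<inter> p. holds M e \<phi>" "\<forall>\<psi>\<in>\<Psi>. \<not> holds M e \<psi>"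
    unfolding proves_disj_def using \<Delta>(2) by (meson Int_lower2 finite_Int)
  then have "\<forall>\<phi>\<in>\<Delta>. holds M e \<phi>" using \<Delta>(1) by (auto simp: \<Psi>_def)
  then show "\<exists>e. \<forall>\<phi>\<in>\<Delta>. holds M e \<phi>" by blast
qed

lemma not_forks_if_negations_of_dividing:
  assumes "consistent M q" and neg: "Neg ` {\<psi>. divides L M A x \<psi>} \<subseteq> q"
  shows "\<not> forks L M A x q"
proof
  assume "forks L M A x q"
  then obtain \<Psi> \<Delta> where \<Psi>: "finite \<Psi>" "\<forall>\<psi>\<in>\<Psi>. divides L M A x \<psi>" and \<Delta>: "\<Delta> \<subseteq> q" "finite \<Delta>"
    "\<forall>e. (\<forall>\<phi>\<in>\<Delta>. holds M e \<phi>) \<longrightarrow> (\<exists>\<psi>\<in>\<Psi>. holds M e \<psi>)"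
    unfolding forks_def proves_disj_def by meson
  have "\<Delta> \<union> Neg ` \<Psi> \<subseteq> q" "finite (\<Delta> \<union> Neg ` \<Psi>)" using \<Delta> \<Psi> neg by auto
  then obtain e where "\<forall>\<phi>\<in>\<Delta> \<union> Neg ` \<Psi>. holds M e \<phi>" by (rule consistentD[OF assms(1)])
  then show False using \<Delta>(3) by (auto simp: ball_Un)
qed

lemma nonforking_extension_exists:
  assumes p: "p \<subseteq> fmls L x C" and nf: "\<not> forks L M A x p"
  obtains q where "nonforking_extension L M A C x p q"
proof -
  have "p \<union> Neg ` {\<psi>. divides L M A x \<psi>} \<subseteq> fmls L x UNIV"
    using p divides_fmls fmls_mono[of x x C UNIV L] by auto
  from this consistent_negations_of_dividing[OF nf]
  obtain q where q: "p \<union> Neg ` {\<psi>. divides L M A x \<psi>} \<subseteq> q" "complete_type L M UNIV x q"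
    by (rule complete_extension)
  then have "\<not> forks L M A x q"
    by (intro not_forks_if_negations_of_dividing) (auto simp: complete_type_def)
  then have "nonforking_extension L M A UNIV x p q"
    using q by (simp add: nonforking_extension_def)
  from nonforking_extension_restrict[OF this subset_refl p] show thesis using that by simp
qed

text \<open>Sequences of conjugates of the formula itself make dividing independent of its presentation as
  \<open>\<phi>(x, d)\<close>.\<close>

lemma dividesI_Aut:
  fixes \<psi> :: "('f, 'r, 'v + 'm) fm" and g :: "nat \<Rightarrow> 'm \<Rightarrow> 'm"
  assumes \<psi>: "\<psi> \<in> fmls L x UNIV" and g: "\<And>i. g i \<in> Aut L M A"
    and inc: "k_inconsistent M k (\<lambda>i. map_params (g i) \<psi>)"
  shows "divides L M A x \<psi>"
proof -
  obtain d :: "nat \<Rightarrow> 'm" and n where d: "params \<psi> = d ` {..<n}"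
    using finite_imp_nat_seg_image_inj_on[OF finite_params] by (metis lessThan_def)
  define \<phi> where "\<phi> = map_params (inv_into {..<n} d) \<psi>"
  have inst: "inst (f \<circ> d) \<phi> = map_params f \<psi>" for f :: "'m \<Rightarrow> 'm"
    unfolding \<phi>_def inst_eq_map_params map_params_map_params
    by (intro map_params_cong) (simp add: d f_inv_into_f)
  have "\<phi> \<in> fmls L x (inv_into {..<n} d ` params \<psi>)"
    unfolding \<phi>_def using \<psi> by (intro map_params_fmls) (simp add: fmls_iff)
  then have "\<phi> \<in> fmls L x {..<n}"
    using inv_into_into[of _ d "{..<n}"] by (fastforce simp: fmls_iff d)
  moreover have "\<psi> = inst d \<phi>" using inst[of id] by (simp add: map_params_ident)
  moreover have "\<forall>i. tp L M A {..<n} (g i \<circ> d) = tp L M A {..<n} d" using tp_Aut[OF g] by blast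
  moreover have "k_inconsistent M k (\<lambda>i. inst (g i \<circ> d) \<phi>)" using inc by (simp add: inst)
  ultimately have "\<exists>k c. (\<forall>i::nat. tp L M A {..<n} (c i) = tp L M A {..<n} d) \<and>
      k_inconsistent M k (\<lambda>i. inst (c i) \<phi>)"
    by (intro exI[of _ k] exI[of _ "\<lambda>i. g i \<circ> d"] conjI)
  with \<open>\<phi> \<in> fmls L x {..<n}\<close> \<open>\<psi> = inst d \<phi>\<close> show ?thesis unfolding divides_def by blast
qed

context monster
begin

lemma divides_Aut:
  assumes A: "small \<kappa> A" and div: "divides L M A x \<psi>"
  shows "\<exists>k g. (\<forall>i::nat. g i \<in> Aut L M A) \<and> k_inconsistent M k (\<lambda>i. map_params (g i) \<psi>)"
proof -
  obtain n \<phi> k c and d :: "nat \<Rightarrow> 'm" where \<phi>: "\<phi> \<in> fmls L x {..<n}" "\<psi> = map_params d \<phi>"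
    and c: "\<forall>i::nat. tp L M A {..<n} (c i) = tp L M A {..<n} d"
    and inc: "k_inconsistent M k (\<lambda>i. map_params (c i) \<phi>)"
    using div unfolding divides_def inst_eq_map_params by blast
  have "\<exists>h\<in>Aut L M A. \<forall>j<n. h (d j) = c i j" for i
  proof -
    have "small \<kappa> {..<n}" by (simp add: small_countable)
    from same_type_Aut[OF A this spec[OF c]] show ?thesis by (metis lessThan_iff)
  qed
  then obtain g where g: "\<And>i. g i \<in> Aut L M A" "\<And>i j. j < n \<Longrightarrow> g i (d j) = c i j" by metis
  have "map_params (g i) \<psi> = map_params (c i) \<phi>" for i
    unfolding \<phi>(2) map_params_map_params using g(2) \<phi>(1)
    by (intro map_params_cong) (auto simp: fmls_iff)
  with inc have "k_inconsistent M k (\<lambda>i. map_params (g i) \<psi>)" by simp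
  with g(1) show ?thesis by blast
qed

lemma divides_automorphism:
  assumes A: "small \<kappa> A" and g: "automorphism L M g" and "divides L M A x \<psi>"
  shows "divides L M (g ` A) x (map_params g \<psi>)"
proof -
  have \<psi>: "\<psi> \<in> fmls L x UNIV" using assms(3) by (rule divides_fmls)
  obtain k and f :: "nat \<Rightarrow> 'm \<Rightarrow> 'm" where f: "\<And>i. f i \<in> Aut L M A"
    and inc: "k_inconsistent M k (\<lambda>i. map_params (f i) \<psi>)"
    using divides_Aut[OF A assms(3)] by blast
  have "map_params g (map_params (f i) \<psi>) = map_params (g \<circ> f i \<circ> inv g) (map_params g \<psi>)" for i
    unfolding map_params_map_params
    using automorphism_inv_apply[OF g] by (intro map_params_cong) simp
  then have "k_inconsistent M k (\<lambda>i. map_params (g \<circ> f i \<circ> inv g) (map_params g \<psi>))"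
    using k_inconsistent_automorphism[OF g _ inc] \<psi> by (simp add: fmls_iff)
  moreover have "map_params g \<psi> \<in> fmls L x UNIV"
    using map_params_fmls[OF \<psi>] fmls_mono[OF subset_refl subset_UNIV] by blast
  ultimately show ?thesis using Aut_conjugate[OF g f] by (intro dividesI_Aut)
qed

lemma forks_automorphism:
  assumes A: "small \<kappa> A" and g: "automorphism L M g" and "forks L M A x (tp L M C x b)"
  shows "forks L M (g ` A) x (tp L M (g ` C) x (g \<circ> b))"
proof -
  obtain \<Psi> \<Delta> where \<Psi>: "finite \<Psi>" "\<forall>\<psi>\<in>\<Psi>. divides L M A x \<psi>"
    and \<Delta>: "\<Delta> \<subseteq> tp L M C x b" "finite \<Delta>"
    and imp: "\<forall>e. (\<forall>\<phi>\<in>\<Delta>. holds M e \<phi>) \<longrightarrow> (\<exists>\<psi>\<in>\<Psi>. holds M e \<psi>)"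
    using assms(3) unfolding forks_def proves_disj_def by meson
  have wff: "wff L 0 \<phi>" if "\<phi> \<in> \<Delta> \<union> \<Psi>" for \<phi>
    using that \<Delta>(1) \<Psi>(2) divides_fmls by (fastforce simp: tp_def fmls_iff)
  have "\<exists>\<psi>\<in>map_params g ` \<Psi>. holds M e \<psi>" if "\<forall>\<phi>\<in>map_params g ` \<Delta>. holds M e \<phi>" for e
    using imp that holds_automorphism[OF g wff] by auto
  moreover have "map_params g ` \<Delta> \<subseteq> tp L M (g ` C) x (g \<circ> b)"
  proof -
    have "inv g \<circ> (g \<circ> b) = b" using automorphism_inv_apply[OF g] by auto
    then show ?thesis
      using \<Delta>(1) wff holds_automorphism[OF g, of _ "g \<circ> b"] map_params_fmls by (fastforce simp: tp_def)
  qed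
  moreover have "\<forall>\<psi>\<in>map_params g ` \<Psi>. divides L M (g ` A) x \<psi>"
    using \<Psi>(2) divides_automorphism[OF A g] by blast
  moreover have "finite (map_params g ` \<Psi>)" "finite (map_params g ` \<Delta>)" using \<Psi> \<Delta> by auto
  ultimately show ?thesis unfolding forks_def proves_disj_def by meson
qed

text \<open>The pigeonhole principle for the finitely many conjugates over \<open>C\<close> of \<open>b\<restriction>x\<close>.\<close>

lemma algebraic_not_divides:
  fixes \<psi> :: "('f, 'r, 'v + 'm) fm"
  assumes C: "small \<kappa> C" and div: "divides L M C x \<psi>" and alg: "b ` x \<subseteq> acl L M C"
  shows "\<not> holds M b \<psi>"
proof
  assume "holds M b \<psi>"
  have \<psi>: "wff L 0 \<psi>" "fvars \<psi> \<subseteq> x" using divides_fmls[OF div] by (simp_all add: fmls_iff)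
  obtain k and g :: "nat \<Rightarrow> 'm \<Rightarrow> 'm" where g: "\<And>i. g i \<in> Aut L M C"
    and inc: "k_inconsistent M k (\<lambda>i. map_params (g i) \<psi>)"
    using divides_Aut[OF C div] by blast
  define conjugate where "conjugate i v = (if v \<in> fvars \<psi> then g i (b v) else undefined)" for i v
  define Z where "Z = (\<Union>v\<in>fvars \<psi>. (\<lambda>h. h (b v)) ` Aut L M C)"
  have "b v \<in> acl L M C" if "v \<in> fvars \<psi>" for v using that \<psi>(2) alg by auto
  then have "finite Z" by (auto simp: Z_def intro: acl_finite_orbit)
  then have "finite {s. \<forall>v. (v \<in> fvars \<psi> \<longrightarrow> s v \<in> Z) \<and> (v \<notin> fvars \<psi> \<longrightarrow> s v = undefined)}"
    by (intro finite_set_of_finite_funs finite_fvars)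
  moreover have "range conjugate \<subseteq>
      {s. \<forall>v. (v \<in> fvars \<psi> \<longrightarrow> s v \<in> Z) \<and> (v \<notin> fvars \<psi> \<longrightarrow> s v = undefined)}"
    using g by (fastforce simp: conjugate_def Z_def)
  ultimately have "finite (range conjugate)" by (rule finite_subset[rotated])
  then obtain i\<^sub>0 where "infinite {i. conjugate i = conjugate i\<^sub>0}"
    using pigeonhole_infinite[of UNIV conjugate] by auto
  then obtain I where I: "finite I" "card I = k" "I \<subseteq> {i. conjugate i = conjugate i\<^sub>0}"
    using infinite_arbitrarily_large by blast
  have "holds M (conjugate i\<^sub>0) (map_params (g i) \<psi>)" if "i \<in> I" for i
  proof -
    have gi: "automorphism L M (g i)" using Aut_automorphism[OF g] .
    have "conjugate i\<^sub>0 = conjugate i" using that I(3) by auto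
    then have "holds M (inv (g i) \<circ> conjugate i\<^sub>0) \<psi> \<longleftrightarrow> holds M b \<psi>"
      by (intro holds_cong) (simp add: conjugate_def automorphism_inv_apply[OF gi])
    with \<open>holds M b \<psi>\<close> show ?thesis using holds_automorphism[OF gi \<psi>(1)] by blast
  qed
  with inc I(1,2) show False unfolding k_inconsistent_iff by blast
qed

end

section \<open>Independence\<close>

lemma ex_agreeing_on_Inr:
  "(\<exists>e'. (\<forall>v\<in>range Inr. e' v = e v) \<and> P e') \<longleftrightarrow> (\<exists>u. P (case_sum u (e \<circ> Inr)))"
proof -
  have "(\<forall>v\<in>range Inr. e' v = e v) \<longleftrightarrow> (\<exists>u. e' = case_sum u (e \<circ> Inr))" for e'
  proof
    assume "\<forall>v\<in>range Inr. e' v = e v"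
    then have "e' = case_sum (e' \<circ> Inl) (e \<circ> Inr)" by (auto split: sum.splits)
    then show "\<exists>u. e' = case_sum u (e \<circ> Inr)" by blast
  qed auto
  then show ?thesis by (simp only:) auto
qed

definition consistent_copies ::
  "('f, 'r, 'm) struct \<Rightarrow> ('f, 'r, 'v + 'c) fm \<Rightarrow> ('v + 'i \<times> 'c \<Rightarrow> 'm) \<Rightarrow> 'i set \<Rightarrow> bool" where
  "consistent_copies M \<psi> e J \<longleftrightarrow> consistent M ((\<lambda>i. map_params (e \<circ> Inr \<circ> Pair i) \<psi>) ` J)"

lemma inconsistency_formula:
  fixes \<psi> :: "('f, 'r, 'v + 'c) fm" and M :: "('f, 'r, 'm) struct"
  assumes \<psi>: "\<psi> \<in> fmls L x D" and J: "finite J"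
  shows "\<exists>\<chi>\<in>fmls L (Inr ` (UNIV \<times> D) :: ('v + 'i \<times> 'c) set) {}.
    \<forall>e. holds M e \<chi> \<longleftrightarrow> \<not> consistent_copies M \<psi> e J"
proof -
  define copy :: "'i \<Rightarrow> ('f, 'r, ('v + 'i \<times> 'c) + 'm) fm" where
    "copy i = map_fm (Inl \<circ> map_sum id (Pair i)) \<psi>" for i
  have holds_copy: "holds M e (copy i) \<longleftrightarrow> holds M (e \<circ> Inl) (map_params (e \<circ> Inr \<circ> Pair i) \<psi>)"
    for e i
  proof -
    have "case_sum e id \<circ> (Inl \<circ> map_sum id (Pair i)) = case_sum (e \<circ> Inl) (e \<circ> Inr \<circ> Pair i)"
      by (auto split: sum.splits)
    then show ?thesis unfolding holds_map_params by (simp add: holds_def copy_def sat_map)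
  qed
  have "copy i \<in> fmls L (x <+> UNIV \<times> D) {}" for i
    unfolding copy_def using \<psi> by (rule map_fmls) auto
  then have "copy ` J \<subseteq> fmls L (x <+> UNIV \<times> D) {}" by blast
  then obtain \<chi> where \<chi>: "\<chi> \<in> fmls L ((x <+> UNIV \<times> D) \<inter> range Inr) {}"
    and holds_\<chi>: "\<forall>e. holds M e \<chi> \<longleftrightarrow>
      (\<exists>e'. (\<forall>v\<in>range Inr. e' v = e v) \<and> (\<forall>\<phi>\<in>copy ` J. holds M e' \<phi>))"
    by (rule bexE[OF projection_formula[OF finite_imageI[OF J]]])
  have "holds M e \<chi> \<longleftrightarrow> consistent_copies M \<psi> e J" for e
  proof -
    have "holds M e \<chi> \<longleftrightarrow> (\<exists>u. \<forall>i\<in>J. holds M (case_sum u (e \<circ> Inr)) (copy i))"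
      using holds_\<chi> unfolding ex_agreeing_on_Inr by simp
    then show ?thesis using J
      by (simp add: consistent_copies_def consistent_finite holds_copy comp_def)
  qed
  moreover have "(x <+> UNIV \<times> D) \<inter> range Inr \<subseteq> Inr ` (UNIV \<times> D)" by auto
  then have "Neg \<chi> \<in> fmls L (Inr ` (UNIV \<times> D)) {}"
    using subsetD[OF fmls_mono[OF _ subset_refl] \<chi>] by simp
  ultimately show ?thesis by (intro bexI[of _ "Neg \<chi>"]) simp_all
qed

text \<open>A realization consists of elements \<open>a\<close> and \<open>c\<^sub>i\<close> such that \<open>a c\<^sub>i\<close> satisfies \<open>\<Delta>\<close> for all \<open>i < N\<close> and
  no \<open>k\<close> of the formulas \<open>\<psi>(x, c\<^sub>0), \<dots>, \<psi>(x, c\<^sub>N\<^sub>-\<^sub>1)\<close> are jointly satisfiable.\<close>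

definition inconsistent_copies ::
  "('f, 'r) lang \<Rightarrow> ('f, 'r, 'm) struct \<Rightarrow> nat \<Rightarrow> 'm set \<Rightarrow> ('f, 'r, 'v + 'm) fm \<Rightarrow> nat \<Rightarrow>
    ('f, 'r, ('v + 'm) + 'm) fm set \<Rightarrow> ('f, 'r, ('v + nat \<times> 'm) + 'm) fm set" where
  "inconsistent_copies L M k D \<psi> N \<Delta> =
    (\<Union>i<N. map_fm (map_sum (map_sum id (Pair i)) id) ` \<Delta>) \<union>
    (\<Union>J\<in>{J. J \<subseteq> {..<N} \<and> card J = k}.
      {\<chi> \<in> fmls L (Inr ` (UNIV \<times> D)) {}. \<forall>e. holds M e \<chi> \<longleftrightarrow> \<not> consistent_copies M \<psi> e J})"

lemma inconsistent_copies_mono: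
  assumes "N \<le> N'" and "\<Delta> \<subseteq> \<Delta>'"
  shows "inconsistent_copies L M k D \<psi> N \<Delta> \<subseteq> inconsistent_copies L M k D \<psi> N' \<Delta>'"
  unfolding inconsistent_copies_def
  using assms by (intro Un_mono UN_mono image_mono subset_refl) auto

lemma inconsistent_copies_fmls:
  assumes "\<Delta> \<subseteq> fmls L (y <+> D) A"
  shows "inconsistent_copies L M k D \<psi> N \<Delta> \<subseteq> fmls L (y <+> UNIV \<times> D) A"
proof -
  have "map_fm (map_sum (map_sum id (Pair i)) id) \<rho> \<in> fmls L (y <+> UNIV \<times> D) A" if "\<rho> \<in> \<Delta>" for i \<rho>
    using subsetD[OF assms that] by (rule map_fmls) auto
  moreover have "fmls L (Inr ` (UNIV \<times> D)) {} \<subseteq> fmls L (y <+> UNIV \<times> D) A"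
    by (intro fmls_mono) auto
  ultimately show ?thesis unfolding inconsistent_copies_def
    by (intro Un_least UN_least image_subsetI subset_trans[OF Collect_restrict])
qed

lemma realizes_inconsistent_copies_iff:
  fixes \<psi> :: "('f, 'r, 'v + 'm) fm" and M :: "('f, 'r, 'm) struct"
  assumes \<psi>: "\<psi> \<in> fmls L x D" and \<Delta>: "\<Delta> \<subseteq> fmls L z A"
  shows "realizes M e (inconsistent_copies L M k D \<psi> N \<Delta>) \<longleftrightarrow>
    (\<forall>i<N. \<forall>\<rho>\<in>\<Delta>. holds M (e \<circ> map_sum id (Pair i)) \<rho>) \<and>
    (\<forall>J\<subseteq>{..<N}. card J = k \<longrightarrow> \<not> consistent_copies M \<psi> e J)"
proof -
  have "holds M e (map_fm (map_sum (map_sum id (Pair i)) id) \<rho>) \<longleftrightarrow> holds M (e \<circ> map_sum id (Pair i)) \<rho>"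
    if "\<rho> \<in> \<Delta>" for i \<rho>
    using subsetD[OF \<Delta> that] by (rule holds_map) auto
  moreover have "(\<forall>\<chi>\<in>{\<chi> \<in> fmls L (Inr ` (UNIV \<times> D)) {}.
        \<forall>e. holds M e \<chi> \<longleftrightarrow> \<not> consistent_copies M \<psi> e J}. holds M e \<chi>) \<longleftrightarrow> \<not> consistent_copies M \<psi> e J"
    if "J \<subseteq> {..<N}" for J
    using inconsistency_formula[OF \<psi> finite_subset[OF that finite_lessThan], of M] by blast
  ultimately show ?thesis
    unfolding realizes_def inconsistent_copies_def ball_Un ball_UN by (simp, auto)
qed

context monster
begin

text \<open>\<open>indep A x b C\<close> stands for the nonforking independence of \<open>b\<restriction>x\<close> and \<open>C\<close> over \<open>A\<close>.\<close>

definition indep :: "'m set \<Rightarrow> 'v set \<Rightarrow> ('v \<Rightarrow> 'm) \<Rightarrow> 'm set \<Rightarrow> bool" where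
  "indep A x b C \<longleftrightarrow> \<not> forks L M A x (tp L M (A \<union> C) x b)"

lemma indep_mono:
  assumes "indep A x b C" and "A \<subseteq> A'" and "A' \<union> C' \<subseteq> A \<union> C" and "x' \<subseteq> x"
  shows "indep A' x' b C'"
  using assms forks_mono[OF _ assms(2,4) tp_mono[OF assms(3,4)]] unfolding indep_def by blast

lemma indep_cong: "(\<And>v. v \<in> x \<Longrightarrow> b v = b' v) \<Longrightarrow> indep A x b C \<longleftrightarrow> indep A x b' C"
  unfolding indep_def using tp_cong by metis

lemma indep_automorphism:
  assumes A: "small \<kappa> A" and g: "automorphism L M g" and "indep A x b C"
  shows "indep (g ` A) x (g \<circ> b) (g ` C)"
proof -
  have inv: "inv g ` g ` D = D" "inv g \<circ> (g \<circ> b) = b" for D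
    using automorphism_inv_apply[OF g] by (auto simp: image_image)
  have "g ` A \<union> g ` C = g ` (A \<union> C)" by auto
  then show ?thesis
    using assms(3) forks_automorphism[OF small_image[OF A] automorphism_inv[OF g],
        of g x "g ` (A \<union> C)" "g \<circ> b"]
    unfolding indep_def inv by metis
qed

lemma indep_extension:
  assumes A: "small \<kappa> A" and C: "small \<kappa> C" and D: "small \<kappa> D" and x: "small \<kappa> x"
    and indep: "indep A x b C"
  shows "\<exists>h\<in>Aut L M (A \<union> C). indep A x (h \<circ> b) (C \<union> D)"
proof -
  have "tp L M (A \<union> C) x b \<subseteq> fmls L x (A \<union> (C \<union> D))" by (auto simp: tp_def fmls_iff)
  from nonforking_extension_exists[OF this indep[unfolded indep_def]] obtain q
    where "nonforking_extension L M A (A \<union> (C \<union> D)) x (tp L M (A \<union> C) x b) q" .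
  then have q: "complete_type L M (A \<union> (C \<union> D)) x q" "tp L M (A \<union> C) x b \<subseteq> q" "\<not> forks L M A x q"
    by (simp_all add: nonforking_extension_def)
  have "small \<kappa> (A \<union> (C \<union> D))" by (intro small_Un A C D)
  then obtain e where e: "realizes M e q"
    using consistent_realizable[OF x] q(1) unfolding complete_type_def by blast
  then have "tp L M (A \<union> C) x e = tp L M (A \<union> C) x b"
    using q(2) unfolding realizes_tp_iff[symmetric] by (auto simp: realizes_def)
  then obtain h where h: "h \<in> Aut L M (A \<union> C)" "\<And>v. v \<in> x \<Longrightarrow> h (b v) = e v"
    using same_type_Aut[OF small_Un[OF A C] x] by blast
  have "q = tp L M (A \<union> (C \<union> D)) x e" using q(1) e by (rule complete_type_realized)
  then have "indep A x e (C \<union> D)" using q(3) by (simp add: indep_def)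
  then have "indep A x (h \<circ> b) (C \<union> D)" using indep_cong[of x "h \<circ> b" e] h(2) by simp
  with h(1) show ?thesis by blast
qed

lemma indep_conjugates_consistent:
  fixes g :: "nat \<Rightarrow> 'm \<Rightarrow> 'm"
  assumes "indep A y a C" and \<chi>: "\<chi> \<in> tp L M (A \<union> C) y a" and g: "\<forall>i. g i \<in> Aut L M A"
  shows "\<exists>u (s :: nat \<Rightarrow> nat). inj_on s {..<N} \<and> (\<forall>i<N. holds M u (map_params (g (s i)) \<chi>))"
proof -
  have "proves_disj M (tp L M (A \<union> C) y a) {\<chi>}"
    unfolding proves_disj_def using \<chi> by (intro exI[of _ "{\<chi>}"]) simp
  then have "\<not> divides L M A y \<chi>" using assms(1) by (auto simp: indep_def forks_def)
  moreover have "\<chi> \<in> fmls L y UNIV" using \<chi> by (auto simp: tp_def fmls_iff)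
  ultimately have "\<not> k_inconsistent M N (\<lambda>i. map_params (g i) \<chi>)" using dividesI_Aut g by blast
  then obtain I u where I: "finite I" "card I = N" "\<forall>i\<in>I. holds M u (map_params (g i) \<chi>)"
    unfolding k_inconsistent_iff by blast
  then obtain s where s: "bij_betw s {..<N} I"
    using ex_bij_betw_nat_finite[OF I(1)] by (auto simp: lessThan_atLeast0)
  have "\<forall>i<N. holds M u (map_params (g (s i)) \<chi>)" using I(3) bij_betw_apply[OF s] by simp
  with s show ?thesis by (auto simp: bij_betw_def)
qed

text \<open>The parameters in \<open>D\<close> are replaced by variables, so that \<open>g\<^sub>i\<close> acts on their values.\<close>

lemma indep_conjugates_satisfiable:
  fixes g :: "nat \<Rightarrow> 'm \<Rightarrow> 'm" and a :: "'v \<Rightarrow> 'm"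
  assumes "indep A y a C" and D: "D \<subseteq> A \<union> C" and g: "\<forall>i. g i \<in> Aut L M A"
    and \<Delta>: "finite \<Delta>" "\<Delta> \<subseteq> tp L M A (y <+> D) (case_sum a id)"
  shows "\<exists>u (s :: nat \<Rightarrow> nat). inj_on s {..<N} \<and> (\<forall>i<N. \<forall>\<rho>\<in>\<Delta>. holds M (case_sum u (g (s i))) \<rho>)"
proof -
  have "\<Delta> \<subseteq> fmls L (y <+> D) A" using \<Delta>(2) by (auto simp: tp_def)
  from bexE[OF conjunction_formula[OF \<Delta>(1) this, of M]] obtain \<rho> where
    \<rho>: "\<rho> \<in> fmls L (y <+> D) A" and holds_\<rho>: "\<forall>e. holds M e \<rho> \<longleftrightarrow> (\<forall>\<phi>\<in>\<Delta>. holds M e \<phi>)" .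
  define \<chi> where "\<chi> = map_fm (case_sum id Inr) \<rho>"
  have \<chi>: "\<chi> \<in> fmls L y (A \<union> C)"
    unfolding \<chi>_def using \<rho> by (rule map_fmls) (use D in auto)
  have holds_g: "holds M u (map_params f \<chi>) \<longleftrightarrow> holds M (case_sum u f) \<rho>"
    if "f \<in> Aut L M A" for u f
  proof -
    have "holds M u (map_params f \<chi>) \<longleftrightarrow> sat M (case_sum u f \<circ> case_sum id Inr) [] \<rho>"
      unfolding holds_map_params \<chi>_def sat_map ..
    also have "\<dots> \<longleftrightarrow> holds M (case_sum u f) \<rho>"
      unfolding holds_def using \<rho> Aut_fixes[OF that] by (intro sat_cong) (auto simp: fmls_def)
    finally show ?thesis .
  qed
  have "id \<in> Aut L M A" by (simp add: Aut_def automorphism_def)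
  then have "holds M a \<chi>"
    using holds_g[of id a] holds_\<rho> \<Delta>(2) by (auto simp: map_params_ident tp_def)
  then have "\<chi> \<in> tp L M (A \<union> C) y a" using \<chi> by (simp add: tp_def)
  from indep_conjugates_consistent[OF assms(1) this g] show ?thesis
    by (simp add: holds_g g holds_\<rho>)
qed

lemma inconsistent_copies_realizable:
  fixes b :: "'v + 'm \<Rightarrow> 'm" and \<psi> :: "('f, 'r, 'v + 'm) fm"
  assumes A: "small \<kappa> A" and y: "small \<kappa> y" and D: "countable D" and \<psi>: "\<psi> \<in> fmls L x D"
    and stages: "\<And>N \<Delta>. finite \<Delta> \<Longrightarrow> \<Delta> \<subseteq> tp L M A (y <+> D) b \<Longrightarrow>
      \<exists>e. realizes M e (inconsistent_copies L M k D \<psi> N \<Delta>)"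
  shows "\<exists>e :: 'v + nat \<times> 'm \<Rightarrow> 'm.
    (\<forall>i. tp L M A (y <+> D) (e \<circ> map_sum id (Pair i)) = tp L M A (y <+> D) b) \<and>
    k_inconsistent M k (\<lambda>i. map_params (e \<circ> Inr \<circ> Pair i) \<psi>)"
proof -
  define R where "R = tp L M A (y <+> D) b"
  define \<Gamma> where "\<Gamma> = \<Union>{inconsistent_copies L M k D \<psi> N \<Delta> | N \<Delta>. finite \<Delta> \<and> \<Delta> \<subseteq> R}"
  have R: "R \<subseteq> fmls L (y <+> D) A" by (auto simp: R_def tp_def)
  have "consistent M \<Gamma>" unfolding \<Gamma>_def
  proof (intro consistent_finite_stages inconsistent_copies_mono)
    show "consistent M (inconsistent_copies L M k D \<psi> N \<Delta>)" if "finite \<Delta>" "\<Delta> \<subseteq> R" for N \<Delta>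
      using stages[of \<Delta> N] that unfolding R_def realizes_def consistent_def by blast
  qed
  moreover have "\<Gamma> \<subseteq> fmls L (y <+> UNIV \<times> D) A"
    using inconsistent_copies_fmls R unfolding \<Gamma>_def by blast
  moreover have "small \<kappa> (y <+> (UNIV :: nat set) \<times> D)"
    using D by (intro small_Plus y small_countable countable_SIGMA) auto
  ultimately obtain e where "realizes M e \<Gamma>" using consistent_realizable[OF _ A] by blast
  then have realized: "realizes M e (inconsistent_copies L M k D \<psi> N \<Delta>)"
    if "finite \<Delta>" "\<Delta> \<subseteq> R" for N \<Delta>
    using that unfolding \<Gamma>_def realizes_def by blast
  have stage: "(\<forall>i<N. \<forall>\<rho>\<in>\<Delta>. holds M (e \<circ> map_sum id (Pair i)) \<rho>) \<and>
      (\<forall>J\<subseteq>{..<N}. card J = k \<longrightarrow> \<not> consistent_copies M \<psi> e J)"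
    if \<Delta>: "finite \<Delta>" "\<Delta> \<subseteq> R" for N \<Delta>
    using realized[OF \<Delta>] unfolding realizes_inconsistent_copies_iff[OF \<psi> subset_trans[OF \<Delta>(2) R]] .
  have "realizes M (e \<circ> map_sum id (Pair i)) R" for i
    using stage[of "{_}" "Suc i"] by (auto simp: realizes_def)
  moreover have "k_inconsistent M k (\<lambda>i. map_params (e \<circ> Inr \<circ> Pair i) \<psi>)"
    unfolding k_inconsistent_def using stage[of "{}"] finite_nat_iff_bounded
    by (auto simp: consistent_copies_def)
  ultimately show ?thesis unfolding R_def realizes_tp_iff by blast
qed

lemma indep_conjugates_realized:
  fixes a :: "'v \<Rightarrow> 'm" and g :: "nat \<Rightarrow> 'm \<Rightarrow> 'm" and \<psi> :: "('f, 'r, 'v + 'm) fm"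
  assumes A: "small \<kappa> A" and y: "small \<kappa> y" and indep: "indep A y a C"
    and D: "countable D" "D \<subseteq> A \<union> C" and \<psi>: "\<psi> \<in> fmls L x D" and g: "\<forall>i. g i \<in> Aut L M A"
    and inc: "k_inconsistent M k (\<lambda>i. map_params (g i) \<psi>)"
  shows "\<exists>e :: 'v + nat \<times> 'm \<Rightarrow> 'm.
    (\<forall>i. tp L M A (y <+> D) (e \<circ> map_sum id (Pair i)) = tp L M A (y <+> D) (case_sum a id)) \<and>
    k_inconsistent M k (\<lambda>i. map_params (e \<circ> Inr \<circ> Pair i) \<psi>)"
proof (rule inconsistent_copies_realizable[OF A y D(1) \<psi>])
  fix N \<Delta> assume \<Delta>: "finite \<Delta>" "\<Delta> \<subseteq> tp L M A (y <+> D) (case_sum a id)"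
  from indep_conjugates_satisfiable[OF indep D(2) g this, of N] obtain u and s :: "nat \<Rightarrow> nat"
    where s: "inj_on s {..<N}" and u: "\<forall>i<N. \<forall>\<rho>\<in>\<Delta>. holds M (case_sum u (g (s i))) \<rho>" by blast
  define e where "e = case_sum u (\<lambda>(i, d). g (s i) d)"
  have e: "e \<circ> map_sum id (Pair i) = case_sum u (g (s i))" "e \<circ> Inr \<circ> Pair i = g (s i)" for i
    by (auto simp: e_def split: sum.splits)
  have "\<not> consistent_copies M \<psi> e J" if J: "J \<subseteq> {..<N}" "card J = k" for J
  proof -
    have "inj_on s J" using s J(1) by (rule inj_on_subset)
    then have "finite (s ` J)" "card (s ` J) = k"
      using J finite_subset[OF J(1)] by (auto simp: card_image)
    then have "\<not> consistent M ((\<lambda>i. map_params (g i) \<psi>) ` s ` J)"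
      using inc unfolding k_inconsistent_def by blast
    then show ?thesis by (simp add: consistent_copies_def e(2) image_image)
  qed
  moreover have "\<Delta> \<subseteq> fmls L (y <+> D) A" using \<Delta>(2) by (auto simp: tp_def)
  ultimately show "\<exists>e. realizes M e (inconsistent_copies L M k D \<psi> N \<Delta>)"
    using u by (intro exI[of _ e]) (simp add: realizes_inconsistent_copies_iff[OF \<psi>] e(1))
qed

text \<open>By compactness, not by indiscernibles: since no formula in \<open>tp(a/Ad)\<close> divides over \<open>A\<close>,
  arbitrarily long finite parts of a sequence witnessing that \<open>\<psi>(x, d)\<close> divides over \<open>A\<close> look like
  realizations of \<open>tp(d/Aa)\<close>.\<close>

lemma indep_divides:
  fixes \<psi> :: "('f, 'r, 'v + 'm) fm" and a :: "'v \<Rightarrow> 'm"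
  assumes A: "small \<kappa> A" and y: "small \<kappa> y" and indep: "indep A y a C"
    and div: "divides L M A x \<psi>" and params: "params \<psi> \<subseteq> A \<union> C"
  shows "divides L M (A \<union> a ` y) x \<psi>"
proof -
  have \<psi>: "\<psi> \<in> fmls L x UNIV" using div by (rule divides_fmls)
  obtain k and g :: "nat \<Rightarrow> 'm \<Rightarrow> 'm" where g: "\<forall>i. g i \<in> Aut L M A"
    and "k_inconsistent M k (\<lambda>i. map_params (g i) \<psi>)"
    using divides_Aut[OF A div] by blast
  moreover have "\<psi> \<in> fmls L x (params \<psi>)" "countable (params \<psi>)"
    using \<psi> by (simp_all add: fmls_iff countable_finite)
  ultimately obtain e :: "'v + nat \<times> 'm \<Rightarrow> 'm" where
    e: "\<And>i. tp L M A (y <+> params \<psi>) (e \<circ> map_sum id (Pair i)) =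
      tp L M A (y <+> params \<psi>) (case_sum a id)"
    and inc: "k_inconsistent M k (\<lambda>i. map_params (e \<circ> Inr \<circ> Pair i) \<psi>)"
    using indep_conjugates_realized[OF A y indep _ params] by blast
  have "small \<kappa> (y <+> params \<psi>)"
    by (intro small_Plus y small_countable countable_finite finite_params)
  then have "\<exists>h\<in>Aut L M A. \<forall>v\<in>y <+> params \<psi>. h (case_sum a id v) = (e \<circ> map_sum id (Pair i)) v"
    for i using same_type_Aut[OF A _ e[of i]] by metis
  then obtain h where h: "\<And>i. h i \<in> Aut L M A"
    and "\<And>i v. v \<in> y <+> params \<psi> \<Longrightarrow> h i (case_sum a id v) = (e \<circ> map_sum id (Pair i)) v"
    by metis
  from this(2)[OF InlI] this(2)[OF InrI]
  have h_a: "\<And>i v. v \<in> y \<Longrightarrow> h i (a v) = e (Inl v)"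
    and h_d: "\<And>i d. d \<in> params \<psi> \<Longrightarrow> h i d = e (Inr (i, d))" by simp_all
  have aut: "automorphism L M (h i)" for i using h by (rule Aut_automorphism)
  have "inv (h 0) \<circ> h i \<in> Aut L M (A \<union> a ` y)" for i
    by (rule Aut_inv_comp[OF h h]) (auto simp: h_a)
  moreover have "map_params (inv (h 0) \<circ> h i) \<psi> =
      map_params (inv (h 0)) (map_params (e \<circ> Inr \<circ> Pair i) \<psi>)" for i
    unfolding map_params_map_params using h_d by (intro map_params_cong) simp
  then have "k_inconsistent M k (\<lambda>i. map_params (inv (h 0) \<circ> h i) \<psi>)"
    using k_inconsistent_automorphism[OF automorphism_inv[OF aut] _ inc] \<psi> by (simp add: fmls_iff)
  ultimately show ?thesis by (rule dividesI_Aut[OF \<psi>])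
qed

lemma indep_acl_not_divides:
  fixes b :: "'v \<Rightarrow> 'm"
  assumes A: "small \<kappa> A" and x: "small \<kappa> x" and y: "small \<kappa> y"
    and indep_y: "indep A y b C" and indep_x: "indep (A \<union> b ` y) x b C"
    and alg: "b ` z \<subseteq> acl L M (A \<union> b ` y \<union> b ` x)"
    and div: "divides L M A z \<psi>" and params: "params \<psi> \<subseteq> C"
  shows "\<not> holds M b \<psi>"
proof -
  have Ay: "small \<kappa> (A \<union> b ` y)" by (intro small_Un small_image A y)
  have "divides L M (A \<union> b ` y) z \<psi>"
    using params by (intro indep_divides[OF A y indep_y div]) auto
  then have "divides L M (A \<union> b ` y \<union> b ` x) z \<psi>"
    using params by (intro indep_divides[OF Ay x indep_x]) auto
  moreover have "small \<kappa> (A \<union> b ` y \<union> b ` x)" by (intro small_Un small_image Ay x)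
  ultimately show ?thesis using algebraic_not_divides alg by blast
qed

lemma indep_pair_extension:
  fixes b :: "'v \<Rightarrow> 'm"
  assumes A: "small \<kappa> A" and B: "small \<kappa> B" and D: "small \<kappa> D" and x: "small \<kappa> x" and y: "small \<kappa> y"
    and indep_y: "indep A y b B" and indep_x: "indep (A \<union> b ` y) x b B"
  shows "\<exists>h\<in>Aut L M (A \<union> B).
    indep A y (h \<circ> b) (B \<union> D) \<and> indep (A \<union> (h \<circ> b) ` y) x (h \<circ> b) (B \<union> D)"
proof -
  obtain g where g: "g \<in> Aut L M (A \<union> B)" and indep_gy: "indep A y (g \<circ> b) (B \<union> D)"
    using indep_extension[OF A B D y indep_y] by blast
  define a where "a = (g \<circ> b) ` y"
  have Aa: "small \<kappa> (A \<union> a)" unfolding a_def by (intro small_Un small_image A y)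
  have "g ` (A \<union> b ` y) = A \<union> a" "g ` B = B"
    using Aut_image[OF g] by (simp_all add: image_Un image_comp a_def)
  then have "indep (A \<union> a) x (g \<circ> b) B"
    using indep_automorphism[OF _ Aut_automorphism[OF g] indep_x] A y
    by (simp add: small_Un small_image)
  from indep_extension[OF Aa B D x this] obtain f where f: "f \<in> Aut L M (A \<union> a \<union> B)"
    and indep_fx: "indep (A \<union> a) x (f \<circ> (g \<circ> b)) (B \<union> D)" by blast
  have f_y: "(f \<circ> (g \<circ> b)) v = (g \<circ> b) v" if "v \<in> y" for v
    using Aut_fixes[OF f] that by (simp add: a_def)
  then have "(f \<circ> (g \<circ> b)) ` y = a" unfolding a_def by (rule image_cong[OF refl])
  moreover have "indep A y (f \<circ> (g \<circ> b)) (B \<union> D)"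
    using indep_gy indep_cong[of y "f \<circ> (g \<circ> b)" "g \<circ> b", OF f_y] by simp
  moreover have "f \<circ> g \<in> Aut L M (A \<union> B)"
    using Aut_comp[OF _ g] f Aut_antimono[of "A \<union> B" "A \<union> a \<union> B"] by blast
  ultimately show ?thesis using indep_fx by (intro bexI[of _ "f \<circ> g"]) (simp_all add: comp_assoc)
qed

lemma indep_left_transitive:
  fixes b :: "'v \<Rightarrow> 'm"
  assumes A: "small \<kappa> A" and B: "small \<kappa> B" and x: "small \<kappa> x" and y: "small \<kappa> y"
    and indep_y: "indep A y b B" and indep_x: "indep (A \<union> b ` y) x b B"
    and alg: "b ` z \<subseteq> acl L M (A \<union> b ` y \<union> b ` x)"
  shows "indep A z b B"
  unfolding indep_def
proof
  assume "forks L M A z (tp L M (A \<union> B) z b)"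
  then obtain \<Psi> \<Delta> where \<Psi>: "finite \<Psi>" "\<forall>\<psi>\<in>\<Psi>. divides L M A z \<psi>" and \<Delta>: "\<Delta> \<subseteq> tp L M (A \<union> B) z b"
    and imp: "\<forall>e. (\<forall>\<phi>\<in>\<Delta>. holds M e \<phi>) \<longrightarrow> (\<exists>\<psi>\<in>\<Psi>. holds M e \<psi>)"
    unfolding forks_def proves_disj_def by meson
  define D where "D = (\<Union>\<psi>\<in>\<Psi>. params \<psi>)"
  have "small \<kappa> D" using \<Psi>(1) by (simp add: D_def small_countable countable_finite)
  from indep_pair_extension[OF A B this x y indep_y indep_x]
  obtain h where h: "h \<in> Aut L M (A \<union> B)" and indep_hy: "indep A y (h \<circ> b) (B \<union> D)"
    and indep_hx: "indep (A \<union> (h \<circ> b) ` y) x (h \<circ> b) (B \<union> D)" by blast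
  have "tp L M (A \<union> B) z (h \<circ> b) = tp L M (A \<union> B) z b" using h by (rule tp_Aut)
  then have "\<forall>\<phi>\<in>\<Delta>. holds M (h \<circ> b) \<phi>" using \<Delta> by (auto simp: tp_def)
  with imp obtain \<psi> where \<psi>: "\<psi> \<in> \<Psi>" "holds M (h \<circ> b) \<psi>" by blast
  have "h ` A = A" using Aut_image[OF h] by simp
  then have "h ` (A \<union> b ` y \<union> b ` x) = A \<union> (h \<circ> b) ` y \<union> (h \<circ> b) ` x"
    by (simp add: image_Un image_comp)
  then have "(h \<circ> b) ` z \<subseteq> acl L M (A \<union> (h \<circ> b) ` y \<union> (h \<circ> b) ` x)"
    using alg acl_automorphism[OF Aut_automorphism[OF h]] by fastforce
  moreover have "params \<psi> \<subseteq> B \<union> D" using \<psi>(1) by (auto simp: D_def)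
  ultimately have "\<not> holds M (h \<circ> b) \<psi>"
    using indep_acl_not_divides[OF A x y indep_hy indep_hx] \<psi>(1) \<Psi>(2) by blast
  with \<psi>(2) show False by simp
qed

section \<open>Unique nonforking extensions\<close>

lemma unique_nonforking_extension_tp_eq:
  assumes AB: "A \<subseteq> B" and p: "p \<subseteq> fmls L z A" and ext: "nonforking_extension L M A B z p q"
    and unique: "\<forall>q'. nonforking_extension L M A B z p q' \<longrightarrow> q' = q" and b: "realizes M b q"
    and eq: "tp L M A z e = tp L M A z b" and indep: "indep A z e B"
  shows "tp L M B z e = tp L M B z b"
proof -
  have q: "q = tp L M B z b" "p \<subseteq> q"
    using ext b complete_type_realized unfolding nonforking_extension_def by blast+
  then have "p \<subseteq> tp L M A z e" using p eq by (auto simp: tp_def)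
  then have "p \<subseteq> tp L M B z e" using tp_mono[OF AB subset_refl] by blast
  moreover have "A \<union> B = B" using AB by blast
  ultimately have "nonforking_extension L M A B z p (tp L M B z e)"
    using indep by (simp add: nonforking_extension_def indep_def complete_type_tp)
  then have "tp L M B z e = q" using unique by blast
  with q(1) show ?thesis by simp
qed

lemma indep_copy:
  fixes b :: "'v \<Rightarrow> 'm"
  assumes A: "small \<kappa> A" and B: "small \<kappa> B" and x: "small \<kappa> x" and y: "small \<kappa> y"
    and indep_y: "indep A y b B" and indep_x: "indep A x b (b ` y)"
    and alg: "b ` z \<subseteq> acl L M (A \<union> b ` y \<union> b ` x)"
  obtains h where "h \<in> Aut L M (A \<union> b ` y)" and "indep A x (h \<circ> b) (b ` y \<union> B)"
    and "indep A z (h \<circ> b) B"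
proof -
  obtain h where h: "h \<in> Aut L M (A \<union> b ` y)" and indep_hx: "indep A x (h \<circ> b) (b ` y \<union> B)"
    using indep_extension[OF A small_image[OF y] B x indep_x] by blast
  have h_y: "(h \<circ> b) v = b v" if "v \<in> y" for v using Aut_fixes[OF h] that by simp
  then have h_image: "(h \<circ> b) ` y = b ` y" by (rule image_cong[OF refl])
  have "indep A z (h \<circ> b) B"
  proof (rule indep_left_transitive[OF A B x y])
    show "indep A y (h \<circ> b) B" using indep_y indep_cong[of y "h \<circ> b" b, OF h_y] by simp
    show "indep (A \<union> (h \<circ> b) ` y) x (h \<circ> b) B"
      using indep_hx unfolding h_image by (rule indep_mono) auto
    have "h ` (A \<union> b ` y \<union> b ` x) = A \<union> (h \<circ> b) ` y \<union> (h \<circ> b) ` x"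
      using Aut_image[OF h, of A] by (simp add: image_Un image_comp)
    then show "(h \<circ> b) ` z \<subseteq> acl L M (A \<union> (h \<circ> b) ` y \<union> (h \<circ> b) ` x)"
      using alg acl_automorphism[OF Aut_automorphism[OF h]] by fastforce
  qed
  with h indep_hx show thesis by (rule that)
qed

lemma unique_nonforking_extension_indep:
  fixes b :: "'v \<Rightarrow> 'm"
  assumes AB: "A \<subseteq> B" and B: "small \<kappa> B" and z: "small \<kappa> z" and xz: "x \<subseteq> z" and yz: "y \<subseteq> z"
    and p: "p \<subseteq> fmls L z A" and ext: "nonforking_extension L M A B z p q"
    and unique: "\<forall>q'. nonforking_extension L M A B z p q' \<longrightarrow> q' = q" and b: "realizes M b q"
    and indep: "indep A x b (b ` y)" and alg: "b ` z \<subseteq> acl L M (A \<union> b ` y \<union> b ` x)"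
  shows "indep B x b (b ` y)"
proof -
  have A: "small \<kappa> A" and x: "small \<kappa> x" and y: "small \<kappa> y"
    using small_subset[OF B AB] small_subset[OF z xz] small_subset[OF z yz] .
  have "q = tp L M B z b"
    using ext b complete_type_realized unfolding nonforking_extension_def by blast
  then have "indep A z b B"
    using ext AB by (simp add: nonforking_extension_def indep_def Un_absorb1)
  then have "indep A y b B" using yz by (intro indep_mono[where x' = y]) auto
  then obtain h where h: "h \<in> Aut L M (A \<union> b ` y)" and indep_x: "indep A x (h \<circ> b) (b ` y \<union> B)"
    and indep_z: "indep A z (h \<circ> b) B"
    using indep_copy[OF A B x y _ indep alg] by blast
  have "tp L M A z (h \<circ> b) = tp L M A z b"
    using h Aut_antimono[of A "A \<union> b ` y"] by (intro tp_Aut) auto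
  then have "tp L M B z (h \<circ> b) = tp L M B z b"
    using indep_z by (rule unique_nonforking_extension_tp_eq[OF AB p ext unique b])
  then obtain f where f: "f \<in> Aut L M B" "\<And>v. v \<in> z \<Longrightarrow> f ((h \<circ> b) v) = b v"
    using same_type_Aut[OF B z, of b "h \<circ> b"] by metis
  have "f (b v) = b v" if "v \<in> y" for v using f(2)[of v] that yz Aut_fixes[OF h] by auto
  then have "f ` b ` y = b ` y" by (simp add: image_image)
  then have "f ` A = A" "f ` (b ` y \<union> B) = b ` y \<union> B"
    using Aut_image[OF f(1)] AB by (simp_all add: image_Un)
  then have "indep A x (f \<circ> (h \<circ> b)) (b ` y \<union> B)"
    using indep_automorphism[OF A Aut_automorphism[OF f(1)] indep_x] by simp
  then have "indep A x b (b ` y \<union> B)"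
    using indep_cong[of x "f \<circ> (h \<circ> b)" b] f(2) xz by auto
  then show ?thesis using AB by (rule indep_mono) auto
qed

lemma independent_iff_indep:
  "independent L M C w X b \<longleftrightarrow> (\<forall>i\<in>w. indep C (X i) b (b ` (\<Union>j\<in>w - {i}. X j)))"
  by (simp add: independent_def indep_def image_UN)

end

lemma amalgamation_systemD:
  assumes "amalgamation_system L M C W x p" and "w \<in> W"
  shows "complete_type L M C (x w) (p w)"
    and "v \<subseteq> w \<Longrightarrow> v \<in> W"
    and "v \<subseteq> w \<Longrightarrow> x v \<subseteq> x w"
    and "v \<subseteq> w \<Longrightarrow> p w \<inter> fmls L (x v) C = p v"
    and "y \<in> x w \<Longrightarrow> z \<in> x w \<Longrightarrow> y \<noteq> z \<Longrightarrow> proves_disj M (p w) {Neg (Eq (At (Inl y)) (At (Inl z)))}"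
    and "realizes M b (p w) \<Longrightarrow> independent L M C w (\<lambda>i. x {i}) b"
    and "realizes M b (p w) \<Longrightarrow> b ` x w \<subseteq> acl L M (C \<union> (\<Union>i\<in>w. b ` x {i}))"
proof -
  show sub: "v \<in> W" if "v \<subseteq> w" for v
    using assms that unfolding amalgamation_system_def by simp
  show "x v \<subseteq> x w" if "v \<subseteq> w"
  proof -
    have "x v \<inter> x w = x (v \<inter> w)"
      using assms sub[OF that] unfolding amalgamation_system_def by simp
    then show ?thesis using that by (metis Int_absorb2 Int_lower2)
  qed
qed (use assms in \<open>simp_all add: amalgamation_system_def\<close>)

lemma amalgamation_system_extension_restrict:
  assumes sys: "amalgamation_system L M A W x p" and "w \<in> W" and "v \<subseteq> w" and AB: "A \<subseteq> B"
    and ext: "nonforking_extension L M A B (x w) (p w) q"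
  shows "nonforking_extension L M A B (x v) (p v) (q \<inter> fmls L (x v) B)"
proof (rule nonforking_extension_restrict[OF ext])
  have "p v = p w \<inter> fmls L (x v) A"
    using amalgamation_systemD(4)[OF sys assms(2,3)] by simp
  then show "p v \<subseteq> p w" "p v \<subseteq> fmls L (x v) B"
    using fmls_mono[OF subset_refl AB] by blast+
qed (use amalgamation_systemD(3)[OF sys assms(2,3)] in auto)

lemma (in monster) amalgamation_system_unique_extension_realized:
  assumes sys: "amalgamation_system L M A W x p" and w: "w \<in> W" and AB: "A \<subseteq> B"
    and B: "small \<kappa> B" and xw: "small \<kappa> (x w)" and ext: "nonforking_extension L M A B (x w) (p w) q"
    and unique: "\<forall>q'. nonforking_extension L M A B (x w) (p w) q' \<longrightarrow> q' = q" and b: "realizes M b q"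
  shows "independent L M B w (\<lambda>i. x {i}) b"
    and "b ` x w \<subseteq> acl L M (B \<union> (\<Union>i\<in>w. b ` x {i}))"
proof -
  have bp: "realizes M b (p w)" using b ext by (auto simp: realizes_def nonforking_extension_def)
  note alg = amalgamation_systemD(7)[OF sys w bp]
  show "b ` x w \<subseteq> acl L M (B \<union> (\<Union>i\<in>w. b ` x {i}))"
    using alg acl_mono[OF Un_mono[OF AB subset_refl]] by (rule subset_trans)
  have x_sub: "x {i} \<subseteq> x w" if "i \<in> w" for i
    using amalgamation_systemD(3)[OF sys w] that by simp
  have pA: "p w \<subseteq> fmls L (x w) A"
    using amalgamation_systemD(1)[OF sys w] by (simp add: complete_type_def)
  show "independent L M B w (\<lambda>i. x {i}) b"
    unfolding independent_iff_indep
  proof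
    fix i assume i: "i \<in> w"
    define y where "y = (\<Union>j\<in>w - {i}. x {j})"
    have "indep B (x {i}) b (b ` y)"
    proof (rule unique_nonforking_extension_indep[OF AB B xw x_sub[OF i] _ pA ext unique b])
      show "y \<subseteq> x w" using x_sub by (auto simp: y_def)
      show "indep A (x {i}) b (b ` y)"
        using amalgamation_systemD(6)[OF sys w bp] i unfolding independent_iff_indep y_def by simp
      have "(\<Union>j\<in>w. b ` x {j}) = b ` y \<union> b ` x {i}" using i by (auto simp: y_def)
      then show "b ` x w \<subseteq> acl L M (A \<union> b ` y \<union> b ` x {i})" using alg by (simp add: Un_assoc)
    qed
    then show "indep B (x {i}) b (b ` (\<Union>j\<in>w - {i}. x {j}))" by (simp add: y_def)
  qed
qed

theorem lemma2p8:
  fixes L :: "('f, 'r) lang" and T :: "('f, 'r, nat) fm set"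
    and \<kappa> :: "'k rel" and M :: "('f, 'r, 'm) struct"
    and A B :: "'m set" and W :: "nat set set" and x :: "nat set \<Rightarrow> 'v set"
    and p q :: "nat set \<Rightarrow> ('f, 'r, 'v + 'm) fm set"
  assumes "complete_theory L T" and "monster_model L T \<kappa> M" and "simple_theory L M"
    and "A \<subseteq> B" and "small \<kappa> B" and "\<forall>w\<in>W. small \<kappa> (x w)"
    and "amalgamation_system L M A W x p"
    and "\<forall>w\<in>W. nonforking_extension L M A B (x w) (p w) (q w) \<and>
           (\<forall>q'. nonforking_extension L M A B (x w) (p w) q' \<longrightarrow> q' = q w)"
  shows "amalgamation_system L M B W x q"
proof -
  interpret monster L T \<kappa> M using assms(2) by unfold_locales
  note sys = amalgamation_systemD[OF assms(7)]
  have ext: "nonforking_extension L M A B (x w) (p w) (q w)"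
    and unique: "\<forall>q'. nonforking_extension L M A B (x w) (p w) q' \<longrightarrow> q' = q w" if "w \<in> W" for w
    using assms(8) that by blast+
  then have q: "complete_type L M B (x w) (q w)" "p w \<subseteq> q w" if "w \<in> W" for w
    using that unfolding nonforking_extension_def by blast+
  have restrict: "q w \<inter> fmls L (x v) B = q v" if "w \<in> W" "v \<subseteq> w" for v w
    using amalgamation_system_extension_restrict[OF assms(7) that assms(4) ext[OF that(1)]]
      unique[OF sys(2)[OF that]] by blast
  have distinct: "proves_disj M (q w) {Neg (Eq (At (Inl y)) (At (Inl z)))}"
    if "w \<in> W" "y \<in> x w" "z \<in> x w" "y \<noteq> z" for w y z
    using sys(5)[OF that] q(2)[OF that(1)] by (rule proves_disj_mono)
  have "independent L M B w (\<lambda>i. x {i}) b" "b ` x w \<subseteq> acl L M (B \<union> (\<Union>i\<in>w. b ` x {i}))"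
    if "w \<in> W" "realizes M b (q w)" for w b
    using amalgamation_system_unique_extension_realized[OF assms(7) that(1) assms(4,5) _
        ext unique that(2)] assms(6) that(1) by simp_all
  with assms(7) q(1) restrict distinct show ?thesis
    unfolding amalgamation_system_def by simp
qed

end
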